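(* Let $(\Omega,\mathcal{F},(\mathcal{F}_i)_{i\ge0},P)$ be a filtered probability space. Let $(\xi_i)$ and $(K_i)$ be real random sequences adapted to $(\mathcal{F}_i)$. Let $n\in\mathbb{N}$ and $\theta\ge1/2$. For all $i\in[n]$, assume $K_{i-1}\ge0$ almost surely, $\mathbb{E}[\xi_i\mid\mathcal{F}_{i-1}]=0$, and $$\mathbb{E}\left[\exp\left((|\xi_i|/K_{i-1})^{1/\theta}\right)\mid\mathcal{F}_{i-1}\right]\le2.$$ If $\theta>1/2$, assume there exist constants $(m_i)$ such that $K_{i-1}\le m_i$ almost surely for all $i\in[n]$. (1) If $\theta=1/2$, then for all $x,\beta\ge0$, $\alpha>0$, and $\lambda\in\left[0,\frac1{2\alpha}\right]$, $$P\left(\bigcup_{k\in[n]}\left\{\sum_{i=1}^k\xi_i\ge x\text{ and }\sum_{i=1}^k2K_{i-1}^2\le\alpha\sum_{i=1}^k\xi_i+\beta\right\}\right)\le\exp(-\lambda x+2\lambda^2\beta),$$ and for all $x,\beta,\lambda\ge0$, $$P\left(\bigcup_{k\in[n]}\left\{\sum_{i=1}^k\xi_i\ge x\text{ and }\sum_{i=1}^k2K_{i-1}^2\le\beta\right\}\right)\le\exp\left(-\lambda x+\frac{\lambda^2}2\beta\right).$$ (2) If $\theta\in\left(\frac12,1\right]$, define $a=(4\theta)^{2\theta}e^2$ and $b=(4\theta)^\theta e$. Then for all $x,\beta\ge0$, $\alpha\ge b\max_{i\in[n]}m_i$, and $\lambda\in\left[0,\frac1{2\alpha}\right]$, $$P\left(\bigcup_{k\in[n]}\left\{\sum_{i=1}^k\xi_i\ge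 x\text{ and }\sum_{i=1}^kaK_{i-1}^2\le\alpha\sum_{i=1}^k\xi_i+\beta\right\}\right)\le\exp(-\lambda x+2\lambda^2\beta),$$ and for all $x,\beta\ge0$ and $\lambda\in\left[0,\frac1{b\max_{i\in[n]}m_i}\right]$, $$P\left(\bigcup_{k\in[n]}\left\{\sum_{i=1}^k\xi_i\ge x\text{ and }\sum_{i=1}^kaK_{i-1}^2\le\beta\right\}\right)\le\exp\left(-\lambda x+\frac{\lambda^2}2\beta\right).$$ (3) If $\theta>1$, let $\delta\in(0,1)$ and define $$a=(2^{2\theta+1}+2)\Gamma(2\theta+1)+\frac{2^{3\theta}\Gamma(3\theta+1)}{3\log(n/\delta)^{\theta-1}},\qquad b=2\log(n/\delta)^{\theta-1}.$$ Then for all $x,\beta\ge0$, $\alpha\ge b\max_{i\in[n]}m_i$, and $\lambda\in\left[0,\frac1{2\alpha}\right]$, $$P\left(\bigcup_{k\in[n]}\left\{\sum_{i=1}^k\xi_i\ge x\text{ and }\sum_{i=1}^kaK_{i-1}^2\le\alpha\sum_{i=1}^k\xi_i+\beta\right\}\right)\le\exp(-\lambda x+2\lambda^2\beta)+2\delta,$$ and for all $x,\beta\ge0$ and $\lambda\in\left[0,\frac1{b\max_{i\in[n]}m_i}\right]$, $$P\left(\bigcup_{k\in[n]}\left\{\sum_{i=1}^k\xi_i\ge x\text{ and }\sum_{i=1}^kaK_{i-1}^2\le\beta\right\}\right)\le\exp\left(-\lambda x+\frac{\lambda^2}2\beta\right)+2\delta.$$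
   Context: $[n]=\{1,\dots,n\}$; $\Gamma$ is the gamma function; $e$ is Euler's number. A sequence is adapted to $(\mathcal{F}_i)$ if its $i$th term is $\mathcal{F}_i$-measurable for each $i$. Conditional (in)equalities are almost sure. Conventions for degenerate values: $0/0=0$ and $c/0=\infty$ for $c>0$ (so $\xi_i=0$ almost surely where $K_{i-1}=0$), and an interval $[0,1/0]$ means $[0,\infty)$. *)

theory Defs
  imports "HOL-Probability.Probability"
begin

text \<open>
  The value of \<open>exp ((\<bar>x\<bar> / k) powr p)\<close> in \<open>[0, \<infinity>]\<close>, for \<open>k \<ge> 0\<close> and \<open>p > 0\<close>, under the
  conventions \<open>0 / 0 = 0\<close> and \<open>c / 0 = \<infinity>\<close> for \<open>c > 0\<close>. HOL's own \<open>c / 0 = 0\<close> is right only when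
  \<open>x = 0\<close>, where the value is \<open>exp 0 = 1\<close>.
\<close>

definition exp_ratio_powr :: "real \<Rightarrow> real \<Rightarrow> real \<Rightarrow> ennreal" where
  "exp_ratio_powr p x k =
     (if k = 0 \<and> x \<noteq> 0 then \<infinity> else ennreal (exp ((\<bar>x\<bar> / k) powr p)))"

text \<open>\<^const>\<open>nn_cond_exp\<close> is \<open>0\<close> by definition on non-measurable functions, so measurability matters here.\<close>

lemma measurable_exp_ratio_powr [measurable (raw)]:
  assumes [measurable]: "f \<in> borel_measurable M" "g \<in> borel_measurable M"
  shows "(\<lambda>\<omega>. exp_ratio_powr p (f \<omega>) (g \<omega>)) \<in> borel_measurable M"
  unfolding exp_ratio_powr_def by measurable

text \<open>The interval \<open>[0, 1 / c]\<close> for \<open>c \<ge> 0\<close>, where \<open>[0, 1 / 0]\<close> means \<open>[0, \<infinity>)\<close>.\<close>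

definition zero_to_recip :: "real \<Rightarrow> real set" where
  "zero_to_recip c = (if c = 0 then {0..} else {0..1 / c})"

end

theory Submission
  imports Defs
begin

text \<open>
  Each part rests on one estimate: for a range of \<open>l \<ge> 0\<close>, the conditional moment generating function of
  the increment, truncated if \<open>\<theta> > 1\<close>, is at most \<open>exp (l\<^sup>2 / 2 * a * K\<^sup>2)\<close> at \<open>l\<close>, where \<open>K\<close> is the
  predictable scale. Given this,
  the exponential of \<open>l\<close> times the martingale minus the accumulated exponents is a supermartingale, and
  Ville's inequality (\<open>maximal_inequality\<close>) controls it at all times simultaneously. The choice \<open>l = lam\<close>
  gives the bound for a deterministic variance budget. The choice \<open>l = 2 * lam\<close> gives the bound for a
  budget that grows with the martingale itself: half of the exponent pays for that growth
  (\<open>tail_bounds_of_mgf\<close>).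

  The estimate is proved pointwise. With \<open>E\<close> for the exponential of \<open>(\<bar>\<xi>\<bar> / K) powr (1 / \<theta>)\<close>, one finds
  \<open>exp (l * \<xi>) \<le> A + c * \<xi> + B * E\<close> with coefficients that depend on \<open>K\<close> only and satisfy
  \<open>A + 2 * B \<le> exp (l\<^sup>2 / 2 * a * K\<^sup>2)\<close>. Conditioning removes \<open>\<xi>\<close> and replaces \<open>E\<close> by at most 2
  (\<open>nn_cond_exp_mgf_le\<close>); no moment series is summed. The domination depends on the tail.

  \<^item> For \<open>\<theta> = 1 / 2\<close> it follows from \<open>exp y \<le> y + exp (y\<^sup>2)\<close> and concavity if \<open>l * K \<le> 1\<close>, and from
    the inequality of arithmetic and geometric means otherwise, so every \<open>l\<close> is allowed.
  \<^item> For \<open>1 / 2 < \<theta> \<le> 1\<close> it is a quadratic Taylor bound whose remainder is at most \<open>E - 1\<close> up to the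
    factor \<open>(l * b * K)\<^sup>2 / 2\<close>, as long as \<open>l * b * K \<le> 1\<close>.
  \<^item> For \<open>\<theta> > 1\<close> the increment need not have exponential moments. It is replaced by zero where it exceeds
    \<open>K * L powr \<theta>\<close> with \<open>L = ln (n / \<delta>)\<close>. On what remains, \<open>l * \<xi>\<close> is at most half the exponent of \<open>E\<close>,
    which leaves the other half to absorb the quadratic Taylor remainder. Only the upper tail is cut, so
    the truncated increment is at most \<open>\<xi>\<close> and the linear term needs no correction. Each truncation has
    an effect with probability at most \<open>2 * \<delta> / n\<close>, whence the additional \<open>2 * \<delta>\<close>.
\<close>

section \<open>Elementary inequalities\<close>

text \<open>
  The factor \<open>exp (max 0 x)\<close> is one on the negative axis. In the heavy-tailed regime this keeps the
  untruncated lower tail harmless; only the upper tail has to be cut off.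
\<close>

lemma exp_le_quadratic:
  fixes x :: real
  shows "exp x \<le> 1 + x + x\<^sup>2 / 2 * exp (max 0 x)"
proof (cases "x \<ge> 0")
  case True
  obtain t where t: "\<bar>t\<bar> \<le> \<bar>x\<bar>" "exp x = (\<Sum>m<2. x ^ m / fact m) + exp t / fact 2 * x\<^sup>2"
    using Maclaurin_exp_le[of x 2] by blast
  have "exp t * x\<^sup>2 \<le> exp x * x\<^sup>2"
    using t(1) True by (intro mult_right_mono) auto
  then show ?thesis using t(2) True by (simp add: numeral_2_eq_2 mult.commute)
next
  case False
  define y where "y = - x"
  have y: "y > 0" using False by (simp add: y_def)
  \<comment> \<open>The quadratic is \<open>((y - 1)\<^sup>2 + 1) / 2\<close>.\<close>
  have pos: "1 - y + y\<^sup>2 / 2 > 0" using zero_le_power2[of "y - 1"] by (simp add: power2_eq_square algebra_simps)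
  have "1 \<le> (1 + y + y\<^sup>2 / 2) * (1 - y + y\<^sup>2 / 2)"
  proof -
    have "(1 + y + y\<^sup>2 / 2) * (1 - y + y\<^sup>2 / 2) = 1 + (y\<^sup>2)\<^sup>2 / 4"
      by (simp add: power2_eq_square field_simps)
    then show ?thesis by simp
  qed
  also have "\<dots> \<le> exp y * (1 - y + y\<^sup>2 / 2)"
    using exp_lower_Taylor_quadratic[of y] y pos by (intro mult_right_mono) auto
  finally have "exp (- y) \<le> 1 - y + y\<^sup>2 / 2" by (simp add: exp_minus field_simps)
  then show ?thesis using False by (simp add: y_def)
qed

text \<open>
  Trades the linear exponent for a quadratic one at the price of a linear term, which has conditional
  mean zero.
\<close>

lemma exp_le_add_exp_square:
  fixes x :: real
  shows "exp x \<le> x + exp (x\<^sup>2)"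
proof (cases "x \<le> 1")
  case True
  have "exp x \<le> 1 + x + x\<^sup>2"
  proof (cases "x \<ge> 0")
    case True
    then show ?thesis using exp_bound[of x] \<open>x \<le> 1\<close> by (simp add: power2_eq_square)
  next
    case False
    then have "exp x \<le> 1 + x + x\<^sup>2 / 2" using exp_le_quadratic[of x] by simp
    then show ?thesis using zero_le_power2[of x] by linarith
  qed
  then show ?thesis using exp_ge_add_one_self[of "x\<^sup>2"] by linarith
next
  case False
  then have "x \<le> x\<^sup>2" by (simp add: power2_eq_square)
  then have "exp x \<le> exp (x\<^sup>2)" by simp
  then show ?thesis using False by linarith
qed

text \<open>
  The tangent line of the concave map \<open>y \<mapsto> y powr t\<close> at \<open>y = exp 1\<close>, with \<open>y = exp s\<close>. It is a
  pointwise substitute for Jensen's inequality: taking the tangent at \<open>exp 1\<close>, which exceeds the bound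
  2 on the conditional expectation of \<open>exp s\<close>, makes the expectation of the right-hand side at most
  \<open>exp t\<close>.
\<close>

lemma exp_scaled_le:
  fixes t s :: real
  assumes "0 \<le> t" "t \<le> 1"
  shows "exp (t * s) \<le> exp t * ((1 - t) + t / exp 1 * exp s)"
proof -
  have "exp ((1 - t) * 0 + t * (s - 1)) \<le> (1 - t) * exp 0 + t * exp (s - 1)"
    using convex_onD[OF exp_convex, of t 0 "s - 1"] assms by (simp add: algebra_simps)
  then have "exp t * exp (t * (s - 1)) \<le> exp t * ((1 - t) + t * exp (s - 1))"
    by (intro mult_left_mono) auto
  then have "exp (t + t * (s - 1)) \<le> exp t * ((1 - t) + t * (exp s / exp 1))"
    by (simp only: mult_exp_exp exp_diff)
  moreover have "t + t * (s - 1) = t * s" by (simp add: algebra_simps)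
  ultimately show ?thesis by simp
qed

text \<open>
  Compare \<open>Gamma (q + 1)\<close>, the integral of \<open>t powr q * exp (- t)\<close>, with the part over \<open>t \<ge> s\<close>, on which
  \<open>t powr q \<ge> s powr q\<close>. The bound turns every polynomial moment into an exponential one without
  integrating tails.
\<close>

lemma powr_mult_exp_minus_le_Gamma:
  fixes q s :: real
  assumes q: "0 \<le> q" and s: "0 \<le> s"
  shows "s powr q * exp (- s) \<le> Gamma (q + 1)"
proof (rule has_integral_le)
  have "((\<lambda>t. s powr q * exp (- 1 * t)) has_integral s powr q * (exp (- 1 * s) / 1)) {s..}"
    by (intro has_integral_mult_right has_integral_exp_minus_to_infinity) auto
  then have "((\<lambda>t. if t \<in> {s..} then s powr q * exp (- t) else 0) has_integral s powr q * exp (- s)) UNIV"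
    by (subst has_integral_restrict_UNIV) simp
  then show "((\<lambda>t. if t \<in> {s..} then s powr q * exp (- t) else 0) has_integral s powr q * exp (- s)) UNIV" .
  show "((\<lambda>t. if t \<in> {0..} then t powr q / exp t else 0) has_integral Gamma (q + 1)) UNIV"
    using Gamma_integral_real[of "q + 1"] q by (subst has_integral_restrict_UNIV) simp
  show "(if t \<in> {s..} then s powr q * exp (- t) else 0) \<le> (if t \<in> {0..} then t powr q / exp t else 0)" for t
    using q s by (auto simp: exp_minus field_simps intro!: powr_mono2)
qed

section \<open>Pointwise domination of the exponential in the three tail regimes\<close>

text \<open>
  With \<open>s = (x / k)\<^sup>2\<close> the first bound comes from \<open>exp (l * x) \<le> l * x + exp (t * s)\<close> and concavity; it
  uses \<open>t \<le> 1\<close>. The second starts from \<open>l * x \<le> t / 2 + s / 2\<close> and is meant for \<open>t \<ge> 1\<close>, where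
  \<open>exp (t / 2 + 1 / 2) \<le> exp t\<close> absorbs the constants.
\<close>

lemma exp_mult_le_subgaussian_scale:
  fixes x k l :: real
  assumes "0 \<le> k" "0 \<le> l" "k = 0 \<Longrightarrow> x = 0"
  defines "t \<equiv> (l * k)\<^sup>2"
  shows "t \<le> 1 \<Longrightarrow> exp (l * x) \<le> exp t * (1 - t) + l * x + exp t * t / exp 1 * exp ((\<bar>x\<bar> / k) powr 2)"
    and "exp (l * x) \<le> exp (t / 2 + 1 / 2) / 2 + exp (t / 2 + 1 / 2) / (2 * exp 1) * exp ((\<bar>x\<bar> / k) powr 2)"
proof -
  define s where "s = (\<bar>x\<bar> / k) powr 2"
  have s: "s = (\<bar>x\<bar> / k)\<^sup>2" using assms by (simp add: s_def powr_numeral)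
  have ts: "t * s = (l * x)\<^sup>2" using assms unfolding s t_def by (cases "k = 0") (auto simp: field_simps)
  show "exp (l * x) \<le> exp t * (1 - t) + l * x + exp t * t / exp 1 * exp ((\<bar>x\<bar> / k) powr 2)" if "t \<le> 1"
  proof -
    have "exp (l * x) \<le> l * x + exp (t * s)" unfolding ts by (rule exp_le_add_exp_square)
    also have "exp (t * s) \<le> exp t * ((1 - t) + t / exp 1 * exp s)"
      using that by (intro exp_scaled_le) (auto simp: t_def)
    finally show ?thesis by (simp add: s_def algebra_simps)
  qed
  have "l * x \<le> t / 2 + s / 2"
  proof -
    have "l * x \<le> (l * k) * (\<bar>x\<bar> / k)" using assms by (cases "k = 0") (auto simp: mult_left_mono)
    also have "\<dots> \<le> t / 2 + s / 2"
      using sum_squares_bound[of "l * k" "\<bar>x\<bar> / k"] unfolding s t_def by linarith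
    finally show ?thesis .
  qed
  then have "exp (l * x) \<le> exp (t / 2) * exp (1 / 2 * s)" by (simp add: mult_exp_exp)
  also have "\<dots> \<le> exp (t / 2) * (exp (1 / 2) * ((1 - 1 / 2) + (1 / 2) / exp 1 * exp s))"
    by (intro mult_left_mono exp_scaled_le) auto
  finally show "exp (l * x) \<le> exp (t / 2 + 1 / 2) / 2 + exp (t / 2 + 1 / 2) / (2 * exp 1) * exp ((\<bar>x\<bar> / k) powr 2)"
    by (simp add: s_def algebra_simps exp_add)
qed

text \<open>
  Since \<open>1 \<le> 1 / \<theta> \<le> 2\<close>, the power \<open>(exp 1 * z) powr (1 / \<theta>)\<close> is at least \<open>exp 1 * z\<close> where that number is
  at least one, and at least its square otherwise. In both ranges the factor \<open>4 * \<theta> \<ge> 2\<close> leaves ample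
  room.
\<close>

lemma square_mult_exp_le:
  fixes z \<theta> :: real
  assumes th: "1 / 2 < \<theta>" "\<theta> \<le> 1" and z: "0 \<le> z"
  shows "z\<^sup>2 * exp z \<le> exp (4 * \<theta> * (exp 1 * z) powr (1 / \<theta>)) - 1"
proof -
  define e :: real where "e = exp 1"
  have e: "5 / 2 \<le> e" "e \<le> 3" using exp_lower_Taylor_quadratic[of 1] exp_le by (auto simp: e_def)
  define g where "g = 4 * \<theta> * (e * z) powr (1 / \<theta>)"
  have p: "1 \<le> 1 / \<theta>" "1 / \<theta> \<le> 2" using th by (auto simp: field_simps)
  show ?thesis
  proof (cases "e * z \<ge> 1")
    case True
    have "(e * z) powr 1 \<le> (e * z) powr (1 / \<theta>)" using True p by (intro powr_mono) auto
    then have "2 * (e * z) \<le> g" unfolding g_def using th True by (intro mult_mono) auto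
    moreover have "5 / 2 * z \<le> e * z" using e z by (intro mult_right_mono) auto
    ultimately have "5 * z \<le> g" by linarith
    then have "exp z * exp (4 * z) \<le> exp g" by (simp add: mult_exp_exp)
    moreover have "exp z * (1 + z\<^sup>2) \<le> exp z * exp (4 * z)"
      using exp_lower_Taylor_quadratic[of "4 * z"] z by (intro mult_left_mono) (auto simp: power2_eq_square intro: order_trans[rotated])
    ultimately have "exp z + z\<^sup>2 * exp z \<le> exp g" by (simp add: algebra_simps)
    then show ?thesis using z unfolding g_def e_def by (smt (verit) one_le_exp_iff)
  next
    case False
    have "5 / 2 * z \<le> e * z" using e z by (intro mult_right_mono) auto
    then have z1: "z \<le> 1" using False by linarith
    have "(e * z) powr 2 \<le> (e * z) powr (1 / \<theta>)"
      using False p z e by (intro powr_mono') auto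
    then have "2 * (e * z)\<^sup>2 \<le> g" unfolding g_def using th z e by (intro mult_mono) (auto simp: powr_numeral)
    moreover have "(5 / 2 * z)\<^sup>2 \<le> (e * z)\<^sup>2" using e z by (intro power_mono mult_right_mono) auto
    moreover have "(5 / 2 * z)\<^sup>2 = 25 / 4 * z\<^sup>2" by (simp add: power2_eq_square)
    moreover have "0 \<le> z\<^sup>2" by simp
    ultimately have "12 * z\<^sup>2 \<le> g" by linarith
    then have "12 * z\<^sup>2 \<le> exp g - 1" using exp_ge_add_one_self[of g] by linarith
    moreover have "z\<^sup>2 * exp z \<le> z\<^sup>2 * e" using z1 unfolding e_def by (intro mult_left_mono) auto
    moreover have "z\<^sup>2 * e \<le> z\<^sup>2 * 3" using e by (intro mult_left_mono) auto
    moreover have "0 \<le> z\<^sup>2" by simp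
    ultimately show ?thesis unfolding g_def e_def by linarith
  qed
qed

text \<open>
  The scale \<open>b\<close> is chosen such that, for \<open>z = \<bar>x\<bar> / (b * k)\<close>, the exponent \<open>(\<bar>x\<bar> / k) powr (1 / \<theta>)\<close> becomes
  \<open>4 * \<theta> * (exp 1 * z) powr (1 / \<theta>)\<close>, so that the quadratic Taylor remainder is controlled by
  \<open>square_mult_exp_le\<close>.
\<close>

lemma exp_mult_le_light_tail:
  fixes x k l \<theta> :: real
  assumes th: "1 / 2 < \<theta>" "\<theta> \<le> 1" and "0 \<le> k" "0 \<le> l" "k = 0 \<Longrightarrow> x = 0"
  defines "b \<equiv> (4 * \<theta>) powr \<theta> * exp 1"
  defines "t \<equiv> (l * b * k)\<^sup>2"
  assumes small: "l * b * k \<le> 1"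
  shows "exp (l * x) \<le> (1 - t / 2) + l * x + t / 2 * exp ((\<bar>x\<bar> / k) powr (1 / \<theta>))"
proof (cases "k = 0")
  case True
  then show ?thesis using assms by simp
next
  case False
  have b: "b > 0" using th by (simp add: b_def)
  define z where "z = \<bar>x\<bar> / (b * k)"
  have z: "z \<ge> 0" "\<bar>x\<bar> / k = (4 * \<theta>) powr \<theta> * (exp 1 * z)"
    using b assms(3) False th by (auto simp: z_def b_def field_simps)
  have E: "(\<bar>x\<bar> / k) powr (1 / \<theta>) = 4 * \<theta> * (exp 1 * z) powr (1 / \<theta>)"
    unfolding z(2) using th z(1) by (simp add: powr_mult powr_powr)
  have lx: "\<bar>l * x\<bar> = (l * b * k) * z"
    using b False assms(3,4) by (simp add: z_def abs_mult)
  have "exp (l * x) \<le> 1 + l * x + (l * x)\<^sup>2 / 2 * exp (max 0 (l * x))" by (rule exp_le_quadratic)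
  also have "(l * x)\<^sup>2 / 2 * exp (max 0 (l * x)) \<le> t / 2 * (z\<^sup>2 * exp z)"
  proof -
    have sq: "(l * x)\<^sup>2 = t * z\<^sup>2" using lx unfolding t_def by (metis power2_abs power_mult_distrib)
    have "\<bar>l * x\<bar> \<le> 1 * z" unfolding lx using small z by (intro mult_right_mono) auto
    then have "exp (max 0 (l * x)) \<le> exp z" using z(1) by simp
    then have "t * z\<^sup>2 / 2 * exp (max 0 (l * x)) \<le> t * z\<^sup>2 / 2 * exp z"
      by (rule mult_left_mono) (simp add: t_def)
    moreover have "t / 2 * (z\<^sup>2 * exp z) = t * z\<^sup>2 / 2 * exp z" by simp
    ultimately show ?thesis unfolding sq by (simp only:)
  qed
  also have "t / 2 * (z\<^sup>2 * exp z) \<le> t / 2 * (exp ((\<bar>x\<bar> / k) powr (1 / \<theta>)) - 1)"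
    unfolding E using th z by (intro mult_left_mono square_mult_exp_le) (auto simp: t_def)
  finally show ?thesis by (simp add: algebra_simps)
qed

text \<open>
  Truncation from above at \<open>k * L powr \<theta>\<close> makes \<open>l * x\<close> at most half of \<open>s = (\<bar>x\<bar> / k) powr (1 / \<theta>)\<close>:
  for \<open>0 < x\<close> the ratio \<open>x / k = s powr \<theta> = s * s powr (\<theta> - 1)\<close> is at most \<open>s * L powr (\<theta> - 1)\<close>. Hence the
  Taylor remainder is of order \<open>s powr (2 * \<theta>) * exp (s / 2)\<close>, which the Gamma bound reduces to a multiple
  of \<open>exp s\<close>. As \<open>T \<le> x\<close>, the linear term can be stated with \<open>x\<close>, whose conditional mean vanishes.
\<close>

lemma exp_truncated_mult_le:
  fixes x k l \<theta> L :: real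
  assumes th: "1 < \<theta>" and "0 \<le> k" "0 \<le> l" "k = 0 \<Longrightarrow> x = 0" and L: "0 < L"
    and small: "l * (2 * L powr (\<theta> - 1)) * k \<le> 1"
  defines "T \<equiv> (if x \<le> k * L powr \<theta> then x else 0)"
  shows "exp (l * T) \<le> 1 + l * x
    + (l * k)\<^sup>2 / 2 * (2 powr (2 * \<theta>) * Gamma (2 * \<theta> + 1)) * exp ((\<bar>x\<bar> / k) powr (1 / \<theta>))"
proof (cases "T = 0")
  case True
  have "0 \<le> x" using True assms(2) L by (auto simp: T_def not_le split: if_splits
      intro: order_trans[of 0 "k * L powr \<theta>"] less_imp_le)
  then show ?thesis using True assms(3) th Gamma_real_pos[of "2 * \<theta> + 1"] by simp
next
  case False
  then have T: "T = x" "x \<le> k * L powr \<theta>" "x \<noteq> 0" by (auto simp: T_def split: if_splits)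
  then have k: "k > 0" using assms by fastforce
  define s where "s = (\<bar>x\<bar> / k) powr (1 / \<theta>)"
  have s: "s > 0" "s powr \<theta> = \<bar>x\<bar> / k" using k T th by (auto simp: s_def powr_powr)
  define G where "G = 2 powr (2 * \<theta>) * Gamma (2 * \<theta> + 1)"
  have x2: "x\<^sup>2 = k\<^sup>2 * s powr (2 * \<theta>)"
    using s k by (simp add: powr_numeral powr_powr[symmetric] mult.commute[of 2] power_divide)
  have G: "s powr (2 * \<theta>) \<le> G * exp (s / 2)"
  proof -
    have "(s / 2) powr (2 * \<theta>) * exp (- (s / 2)) \<le> Gamma (2 * \<theta> + 1)"
      using th s by (intro powr_mult_exp_minus_le_Gamma) auto
    then show ?thesis using s by (simp add: G_def powr_divide exp_minus field_simps)
  qed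
  have m: "max 0 (l * x) \<le> s / 2"
  proof (cases "x > 0")
    case True
    have "s \<le> L"
    proof -
      have "\<bar>x\<bar> / k \<le> L powr \<theta>" using T(2) True k by (simp add: field_simps)
      then have "(\<bar>x\<bar> / k) powr (1 / \<theta>) \<le> (L powr \<theta>) powr (1 / \<theta>)" using th k by (intro powr_mono2) auto
      then show ?thesis using th L by (simp add: s_def powr_powr)
    qed
    have "l * x = l * k * (s * s powr (\<theta> - 1))"
      using s k True by (simp add: powr_diff field_simps)
    also have "\<dots> \<le> l * k * (s * L powr (\<theta> - 1))"
      using \<open>s \<le> L\<close> s assms(2,3) th by (intro mult_left_mono powr_mono2) auto
    also have "\<dots> = (l * (2 * L powr (\<theta> - 1)) * k) * (s / 2)" by simp
    also have "\<dots> \<le> 1 * (s / 2)" using small s by (intro mult_right_mono) auto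
    finally show ?thesis using s by simp
  next
    case False
    then have "l * x \<le> 0" using assms(3) by (simp add: mult_nonneg_nonpos)
    then show ?thesis using s by simp
  qed
  have "exp (l * x) \<le> 1 + l * x + (l * x)\<^sup>2 / 2 * exp (max 0 (l * x))" by (rule exp_le_quadratic)
  also have "(l * x)\<^sup>2 / 2 * exp (max 0 (l * x)) \<le> (l * k)\<^sup>2 / 2 * (G * exp (s / 2)) * exp (s / 2)"
  proof (rule mult_mono)
    have "(l * x)\<^sup>2 / 2 = (l * k)\<^sup>2 / 2 * s powr (2 * \<theta>)" by (simp add: power_mult_distrib x2)
    also have "\<dots> \<le> (l * k)\<^sup>2 / 2 * (G * exp (s / 2))" using G by (intro mult_left_mono) auto
    finally show "(l * x)\<^sup>2 / 2 \<le> (l * k)\<^sup>2 / 2 * (G * exp (s / 2))" .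
    then show "0 \<le> (l * k)\<^sup>2 / 2 * (G * exp (s / 2))" by (rule order_trans[rotated]) simp
  qed (use m in auto)
  also have "\<dots> = (l * k)\<^sup>2 / 2 * G * exp s" by (simp add: mult_exp_exp mult.assoc)
  finally show ?thesis by (simp add: T G_def s_def)
qed

section \<open>A maximal inequality for exponential supermartingales\<close>

text \<open>
  The partial sums of \<open>Y\<close>, frozen at the first time when they reach \<open>r\<close>; the empty sum counts as time zero.
\<close>

primrec stopped_sum :: "real \<Rightarrow> (nat \<Rightarrow> 'a \<Rightarrow> real) \<Rightarrow> nat \<Rightarrow> 'a \<Rightarrow> real" where
  "stopped_sum r Y 0 = (\<lambda>\<omega>. 0)"
| "stopped_sum r Y (Suc k) =
     (\<lambda>\<omega>. stopped_sum r Y k \<omega> + (if r \<le> stopped_sum r Y k \<omega> then 0 else Y (Suc k) \<omega>))"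

lemma stopped_sum_eq_or_above:
  "(stopped_sum r Y k \<omega> = (\<Sum>i=1..k. Y i \<omega>) \<and> (\<forall>j\<in>{1..k}. (\<Sum>i=1..j. Y i \<omega>) < r))
    \<or> r \<le> stopped_sum r Y k \<omega>"
  by (induction k) (auto simp: le_Suc_eq not_le)

lemma measurable_filtration_mono:
  assumes "filtration \<Omega> F" "i \<le> j" "f \<in> measurable (F i) N"
  shows "f \<in> measurable (F j) N"
  using filtration.sets_F_mono[OF assms(1,2)] filtration.space_F[OF assms(1)] assms(3)
  by (auto simp: measurable_def)

lemma measurable_stopped_sum:
  assumes "filtration \<Omega> F" "\<And>i. Y i \<in> borel_measurable (F i)"
  shows "stopped_sum r Y k \<in> borel_measurable (F k)"
proof (induction k)
  case (Suc k)
  have [measurable]: "stopped_sum r Y k \<in> borel_measurable (F (Suc k))"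
    by (rule measurable_filtration_mono[OF assms(1) _ Suc]) simp
  note [measurable] = assms(2)[of "Suc k"]
  show ?case by simp
qed simp

lemma emeasure_one_le_mult_le:
  assumes [measurable]: "f \<in> borel_measurable M"
  shows "emeasure M {\<omega> \<in> space M. 1 \<le> c * f \<omega>} \<le> c * (\<integral>\<^sup>+\<omega>. f \<omega> \<partial>M)"
proof -
  have "emeasure M {\<omega> \<in> space M. 1 \<le> c * f \<omega>} \<le> c * (\<integral>\<^sup>+\<omega>. f \<omega> * indicator (space M) \<omega> \<partial>M)"
    by (rule nn_integral_Markov_inequality) simp_all
  also have "(\<integral>\<^sup>+\<omega>. f \<omega> * indicator (space M) \<omega> \<partial>M) = (\<integral>\<^sup>+\<omega>. f \<omega> \<partial>M)"
    by (intro nn_integral_cong) simp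
  finally show ?thesis .
qed

text \<open>
  Ville's inequality for the supermartingale of the exponentials of the partial sums. Freezing the sums
  when they first reach \<open>r\<close> keeps the expectation of the exponential at most one, and if any partial sum
  reaches \<open>r\<close>, then so does the frozen sum at time \<open>n\<close>. Markov's inequality at time \<open>n\<close> thus
  controls the union over all times.
\<close>

lemma maximal_inequality:
  fixes M :: "'a measure" and Y :: "nat \<Rightarrow> 'a \<Rightarrow> real"
  assumes "prob_space M" and fil: "filtration (space M) F" and sub: "\<And>i. subalgebra M (F i)"
    and Y: "\<And>i. Y i \<in> borel_measurable (F i)"
    and cond: "\<And>i. i \<in> {1..n} \<Longrightarrow>
      AE \<omega> in M. nn_cond_exp M (F (i - 1)) (\<lambda>\<omega>. ennreal (exp (Y i \<omega>))) \<omega> \<le> 1"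
  shows "measure M (\<Union>k\<in>{1..n}. {\<omega> \<in> space M. r \<le> (\<Sum>i=1..k. Y i \<omega>)}) \<le> exp (- r)"
proof -
  interpret prob_space M by fact
  let ?U = "stopped_sum r Y"
  note mU[measurable] = measurable_stopped_sum[OF fil Y, of r]
  have UM[measurable]: "?U k \<in> borel_measurable M" for k
    using measurable_from_subalg[OF sub mU] .
  have YM[measurable]: "Y k \<in> borel_measurable M" for k
    using measurable_from_subalg[OF sub Y] .
  have int: "k \<le> n \<Longrightarrow> (\<integral>\<^sup>+\<omega>. ennreal (exp (?U k \<omega>)) \<partial>M) \<le> 1" for k
  proof (induction k)
    case 0
    then show ?case by (simp add: emeasure_space_1)
  next
    case (Suc k)
    interpret S: finite_measure_subalgebra M "F k" by unfold_locales (rule sub)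
    let ?Z = "\<lambda>\<omega>. ennreal (exp (Y (Suc k) \<omega>))"
    define f where "f \<omega> = (if r \<le> ?U k \<omega> then 0 else ennreal (exp (?U k \<omega>)))" for \<omega>
    define g where "g \<omega> = (if r \<le> ?U k \<omega> then ennreal (exp (?U k \<omega>)) else 0)" for \<omega>
    have [measurable]: "f \<in> borel_measurable (F k)" unfolding f_def by simp
    have [measurable]: "f \<in> borel_measurable M" "g \<in> borel_measurable M" unfolding f_def g_def by simp_all
    \<comment> \<open>Split according to whether the sum is already frozen (\<open>g\<close>) or still moves (\<open>f\<close>).\<close>
    have "(\<integral>\<^sup>+\<omega>. ennreal (exp (?U (Suc k) \<omega>)) \<partial>M) = (\<integral>\<^sup>+\<omega>. g \<omega> + f \<omega> * ?Z \<omega> \<partial>M)"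
      by (intro nn_integral_cong) (simp add: f_def g_def exp_add ennreal_mult)
    also have "\<dots> = (\<integral>\<^sup>+\<omega>. g \<omega> \<partial>M) + (\<integral>\<^sup>+\<omega>. f \<omega> * ?Z \<omega> \<partial>M)"
      by (intro nn_integral_add) simp_all
    also have "\<dots> \<le> (\<integral>\<^sup>+\<omega>. g \<omega> \<partial>M) + (\<integral>\<^sup>+\<omega>. f \<omega> \<partial>M)"
    proof (rule add_left_mono)
      have "(\<integral>\<^sup>+\<omega>. f \<omega> * ?Z \<omega> \<partial>M) = (\<integral>\<^sup>+\<omega>. f \<omega> * nn_cond_exp M (F k) ?Z \<omega> \<partial>M)"
        by (rule S.nn_cond_exp_intg[symmetric]) simp_all
      also have "\<dots> \<le> (\<integral>\<^sup>+\<omega>. f \<omega> \<partial>M)"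
      proof (rule nn_integral_mono_AE)
        have "AE \<omega> in M. nn_cond_exp M (F k) ?Z \<omega> \<le> 1" using cond[of "Suc k"] Suc.prems by simp
        then show "AE \<omega> in M. f \<omega> * nn_cond_exp M (F k) ?Z \<omega> \<le> f \<omega>"
          by eventually_elim (metis mult.right_neutral mult_left_mono zero_le)
      qed
      finally show "(\<integral>\<^sup>+\<omega>. f \<omega> * ?Z \<omega> \<partial>M) \<le> (\<integral>\<^sup>+\<omega>. f \<omega> \<partial>M)" .
    qed
    also have "\<dots> = (\<integral>\<^sup>+\<omega>. g \<omega> + f \<omega> \<partial>M)"
      by (intro nn_integral_add[symmetric]) simp_all
    also have "\<dots> = (\<integral>\<^sup>+\<omega>. ennreal (exp (?U k \<omega>)) \<partial>M)"
      by (intro nn_integral_cong) (simp add: f_def g_def)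
    also have "\<dots> \<le> 1" using Suc by simp
    finally show ?case .
  qed
  have "(\<Union>k\<in>{1..n}. {\<omega> \<in> space M. r \<le> (\<Sum>i=1..k. Y i \<omega>)}) \<subseteq> {\<omega> \<in> space M. 1 \<le> ennreal (exp (- r)) * ennreal (exp (?U n \<omega>))}"
  proof safe
    fix k \<omega> assume k: "k \<in> {1..n}" "r \<le> (\<Sum>i=1..k. Y i \<omega>)"
    then have "r \<le> ?U n \<omega>" using stopped_sum_eq_or_above[of r Y n \<omega>] by (auto simp: not_less[symmetric])
    then show "1 \<le> ennreal (exp (- r)) * ennreal (exp (?U n \<omega>))"
      by (simp add: ennreal_mult[symmetric] mult_exp_exp)
  qed
  then have "measure M (\<Union>k\<in>{1..n}. {\<omega> \<in> space M. r \<le> (\<Sum>i=1..k. Y i \<omega>)}) \<le>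
      measure M {\<omega> \<in> space M. 1 \<le> ennreal (exp (- r)) * ennreal (exp (?U n \<omega>))}"
    by (intro finite_measure_mono) measurable
  also have "\<dots> \<le> exp (- r)"
  proof -
    have "ennreal (measure M {\<omega> \<in> space M. 1 \<le> ennreal (exp (- r)) * ennreal (exp (?U n \<omega>))})
        \<le> ennreal (exp (- r)) * (\<integral>\<^sup>+\<omega>. ennreal (exp (?U n \<omega>)) \<partial>M)"
      unfolding emeasure_eq_measure[symmetric] by (rule emeasure_one_le_mult_le) simp
    also have "\<dots> \<le> ennreal (exp (- r)) * 1" using int[of n] by (intro mult_left_mono) auto
    finally show ?thesis by (simp add: ennreal_le_iff)
  qed
  finally show ?thesis .
qed

section \<open>Conditional moment generating functions\<close>

lemma exp_ratio_powr_finite: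
  assumes "exp_ratio_powr p x k \<noteq> \<infinity>"
  shows "k = 0 \<Longrightarrow> x = 0" "exp_ratio_powr p x k = ennreal (exp ((\<bar>x\<bar> / k) powr p))"
  using assms by (auto simp: exp_ratio_powr_def split: if_splits)

context finite_measure_subalgebra begin

lemma exp_ratio_powr_integral_le:
  assumes [measurable]: "X \<in> borel_measurable M" "K \<in> borel_measurable F"
    and tail: "AE \<omega> in M. nn_cond_exp M F (\<lambda>\<omega>. exp_ratio_powr p (X \<omega>) (K \<omega>)) \<omega> \<le> 2"
  shows "(\<integral>\<^sup>+\<omega>. exp_ratio_powr p (X \<omega>) (K \<omega>) \<partial>M) \<le> 2 * emeasure M (space M)"
proof -
  have [measurable]: "K \<in> borel_measurable M" by (rule measurable_from_subalg[OF subalg]) simp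
  have "(\<integral>\<^sup>+\<omega>. exp_ratio_powr p (X \<omega>) (K \<omega>) \<partial>M)
      = (\<integral>\<^sup>+\<omega>. nn_cond_exp M F (\<lambda>\<omega>. exp_ratio_powr p (X \<omega>) (K \<omega>)) \<omega> \<partial>M)"
    using nn_cond_exp_intg[of "\<lambda>_. 1" "\<lambda>\<omega>. exp_ratio_powr p (X \<omega>) (K \<omega>)"] by simp
  also have "\<dots> \<le> (\<integral>\<^sup>+\<omega>. 2 \<partial>M)" using tail by (rule nn_integral_mono_AE)
  finally show ?thesis by simp
qed

text \<open>
  Takes conditional expectations in a pointwise domination of \<open>exp (l * T)\<close> by a constant, a multiple of
  the centred variable \<open>X\<close> and a multiple of the exponential whose conditional expectation is at most 2,
  where all coefficients are functions of the predictable scale \<open>K\<close>. As \<open>K\<close> may be unbounded, \<open>X\<close> need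
  not be integrable. The argument therefore stays with conditional expectations of nonnegative functions:
  \<open>\<bar>X\<bar>\<close> is at most \<open>K * Gamma (\<theta> + 1)\<close> times the exponential, so its conditional expectation is finite
  almost surely, those of the positive and negative parts agree, and they cancel after the negative
  part has been moved to the other side. Finiteness of the exponential also yields \<open>X = 0\<close> almost surely
  where \<open>K = 0\<close>.
\<close>

lemma nn_cond_exp_mgf_le:
  fixes X T K :: "'a \<Rightarrow> real" and A B c v :: "real \<Rightarrow> real" and \<theta> l :: real
  assumes [measurable]: "X \<in> borel_measurable M" "T \<in> borel_measurable M" "K \<in> borel_measurable F"
    and [measurable]: "A \<in> borel_measurable borel" "B \<in> borel_measurable borel" "c \<in> borel_measurable borel"
    and th: "0 < \<theta>"
    and G: "AE \<omega> in M. K \<omega> \<in> G" "G \<subseteq> {0..}"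
    and centred: "AE \<omega> in M. real_cond_exp M F X \<omega> = 0"
    and tail: "AE \<omega> in M. nn_cond_exp M F (\<lambda>\<omega>. exp_ratio_powr (1 / \<theta>) (X \<omega>) (K \<omega>)) \<omega> \<le> 2"
    and dom: "\<And>\<omega>. K \<omega> \<in> G \<Longrightarrow> (K \<omega> = 0 \<Longrightarrow> X \<omega> = 0) \<Longrightarrow>
      exp (l * T \<omega>) \<le> A (K \<omega>) + c (K \<omega>) * X \<omega> + B (K \<omega>) * exp ((\<bar>X \<omega>\<bar> / K \<omega>) powr (1 / \<theta>))"
    and coeff: "\<And>k. k \<in> G \<Longrightarrow> 0 \<le> A k \<and> 0 \<le> B k \<and> 0 \<le> c k \<and> A k + 2 * B k \<le> v k"
  shows "AE \<omega> in M. nn_cond_exp M F (\<lambda>\<omega>. ennreal (exp (l * T \<omega>))) \<omega> \<le> ennreal (v (K \<omega>))"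
proof -
  have [measurable]: "K \<in> borel_measurable M" by (rule measurable_from_subalg[OF subalg]) simp
  define W where "W \<omega> = exp_ratio_powr (1 / \<theta>) (X \<omega>) (K \<omega>)" for \<omega>
  have [measurable]: "W \<in> borel_measurable M" unfolding W_def by simp
  let ?E = "nn_cond_exp M F"
  let ?P = "\<lambda>\<omega>. ennreal (X \<omega>)" and ?N = "\<lambda>\<omega>. ennreal (- X \<omega>)" and ?Z = "\<lambda>\<omega>. ennreal (exp (l * T \<omega>))"
  have tail': "AE \<omega> in M. ?E W \<omega> \<le> 2" using tail unfolding W_def by simp
  have "(\<integral>\<^sup>+\<omega>. W \<omega> \<partial>M) \<noteq> \<infinity>"
    using exp_ratio_powr_integral_le[OF _ _ tail] finite_emeasure_space
    unfolding W_def by (auto simp: top_unique ennreal_mult_eq_top_iff)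
  then have Wfin: "AE \<omega> in M. W \<omega> \<noteq> \<infinity>" by (intro nn_integral_noteq_infinite) simp_all
  define C where "C = Gamma (\<theta> + 1)"
  have C: "C > 0" using th by (simp add: C_def)
  have abs_le: "AE \<omega> in M. ennreal \<bar>X \<omega>\<bar> \<le> ennreal (K \<omega> * C) * W \<omega>"
    using Wfin G(1)
  proof eventually_elim
    case (elim \<omega>)
    note W = exp_ratio_powr_finite[OF elim(1)[unfolded W_def]]
    show ?case
    proof (cases "K \<omega> = 0")
      case False
      then have k: "K \<omega> > 0" using elim G(2) by (auto simp: less_le)
      define s where "s = (\<bar>X \<omega>\<bar> / K \<omega>) powr (1 / \<theta>)"
      have "s powr \<theta> * exp (- s) \<le> C"
        unfolding C_def using th by (intro powr_mult_exp_minus_le_Gamma) (auto simp: s_def)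
      moreover have "s powr \<theta> = \<bar>X \<omega>\<bar> / K \<omega>" using k th by (simp add: s_def powr_powr)
      ultimately have "\<bar>X \<omega>\<bar> \<le> K \<omega> * C * exp s" using k by (simp add: field_simps exp_minus)
      then show ?thesis using k C unfolding W_def W(2)
        by (simp add: s_def ennreal_mult'[symmetric] del: ennreal_le_iff) (rule ennreal_leI, simp)
    qed (use W in simp)
  qed
  have abs_fin: "AE \<omega> in M. ?E (\<lambda>\<omega>. ennreal \<bar>X \<omega>\<bar>) \<omega> < \<infinity>"
  proof -
    have "AE \<omega> in M. ?E (\<lambda>\<omega>. ennreal \<bar>X \<omega>\<bar>) \<omega> \<le> ?E (\<lambda>\<omega>. ennreal (K \<omega> * C) * W \<omega>) \<omega>"
      by (rule nn_cond_exp_mono[OF abs_le]) simp_all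
    moreover have "AE \<omega> in M. ennreal (K \<omega> * C) * ?E W \<omega> = ?E (\<lambda>\<omega>. ennreal (K \<omega> * C) * W \<omega>) \<omega>"
      by (rule nn_cond_exp_prod) simp_all
    ultimately show ?thesis using tail'
    proof eventually_elim
      case (elim \<omega>)
      have "?E W \<omega> < \<infinity>" using elim(3) by (rule order_le_less_trans) simp
      then show ?case using elim(1,2) by (metis ennreal_mult_less_top ennreal_less_top infinity_ennreal_def order_le_less_trans)
    qed
  qed
  have P: "AE \<omega> in M. ?E ?P \<omega> \<le> ?E (\<lambda>\<omega>. ennreal \<bar>X \<omega>\<bar>) \<omega>"
    by (rule nn_cond_exp_mono) (auto intro!: AE_I2 ennreal_leI)
  have N: "AE \<omega> in M. ?E ?N \<omega> \<le> ?E (\<lambda>\<omega>. ennreal \<bar>X \<omega>\<bar>) \<omega>"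
    by (rule nn_cond_exp_mono) (auto intro!: AE_I2 ennreal_leI)
  have PN: "AE \<omega> in M. ?E ?P \<omega> = ?E ?N \<omega> \<and> ?E ?N \<omega> < \<infinity>"
    using P N abs_fin centred
  proof eventually_elim
    case (elim \<omega>)
    have "?E ?P \<omega> < \<infinity>" "?E ?N \<omega> < \<infinity>" using elim by (auto intro: order_le_less_trans)
    then show ?case using elim(4) unfolding real_cond_exp_def
      by (metis (no_types, lifting) eq_iff_diff_eq_0 ennreal_enn2real infinity_ennreal_def)
  qed
  let ?a = "\<lambda>\<omega>. ennreal (A (K \<omega>))" and ?b = "\<lambda>\<omega>. ennreal (B (K \<omega>))" and ?c = "\<lambda>\<omega>. ennreal (c (K \<omega>))"
  \<comment> \<open>The negative part stands on the left, so that all terms are nonnegative.\<close>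
  have key: "AE \<omega> in M. ?Z \<omega> + ?c \<omega> * ?N \<omega> \<le> (?a \<omega> + ?c \<omega> * ?P \<omega>) + ?b \<omega> * W \<omega>"
    using Wfin G(1)
  proof eventually_elim
    case (elim \<omega>)
    note W = exp_ratio_powr_finite[OF elim(1)[unfolded W_def]]
    note nn = coeff[OF elim(2)]
    define y where "y = exp ((\<bar>X \<omega>\<bar> / K \<omega>) powr (1 / \<theta>))"
    have le: "exp (l * T \<omega>) \<le> A (K \<omega>) + c (K \<omega>) * X \<omega> + B (K \<omega>) * y"
      unfolding y_def by (rule dom[OF elim(2) W(1)])
    have Wy: "W \<omega> = ennreal y" unfolding W_def y_def by (rule W(2))
    have y: "y \<ge> 0" by (simp add: y_def)
    show ?case
    proof (cases "X \<omega> \<ge> 0")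
      case True
      then have "?N \<omega> = 0" by (simp add: ennreal_neg)
      moreover have "(?a \<omega> + ?c \<omega> * ?P \<omega>) + ?b \<omega> * W \<omega> = ennreal (A (K \<omega>) + c (K \<omega>) * X \<omega> + B (K \<omega>) * y)"
        using nn True y unfolding Wy by (simp add: ennreal_mult ennreal_plus)
      ultimately show ?thesis using ennreal_leI[OF le] by simp
    next
      case False
      then have "?P \<omega> = 0" by (simp add: ennreal_neg)
      moreover have "?a \<omega> + ?b \<omega> * W \<omega> = ennreal (A (K \<omega>) + B (K \<omega>) * y)"
        using nn y unfolding Wy by (simp add: ennreal_mult ennreal_plus)
      moreover have "?Z \<omega> + ?c \<omega> * ?N \<omega> = ennreal (exp (l * T \<omega>) + c (K \<omega>) * (- X \<omega>))"
        using nn False by (subst ennreal_plus) (simp_all add: ennreal_mult[symmetric] mult_nonneg_nonpos)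
      moreover have "exp (l * T \<omega>) + c (K \<omega>) * (- X \<omega>) \<le> A (K \<omega>) + B (K \<omega>) * y" using le by simp
      ultimately show ?thesis using ennreal_leI by simp
    qed
  qed
  have m: "AE \<omega> in M. ?E (\<lambda>\<omega>. ?Z \<omega> + ?c \<omega> * ?N \<omega>) \<omega> \<le> ?E (\<lambda>\<omega>. (?a \<omega> + ?c \<omega> * ?P \<omega>) + ?b \<omega> * W \<omega>) \<omega>"
    by (rule nn_cond_exp_mono[OF key]) simp_all
  have l1: "AE \<omega> in M. ?E ?Z \<omega> + ?E (\<lambda>\<omega>. ?c \<omega> * ?N \<omega>) \<omega> = ?E (\<lambda>\<omega>. ?Z \<omega> + ?c \<omega> * ?N \<omega>) \<omega>"
    by (rule nn_cond_exp_sum) simp_all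
  have l2: "AE \<omega> in M. ?c \<omega> * ?E ?N \<omega> = ?E (\<lambda>\<omega>. ?c \<omega> * ?N \<omega>) \<omega>"
    by (rule nn_cond_exp_prod) simp_all
  have r1: "AE \<omega> in M. ?E (\<lambda>\<omega>. ?a \<omega> + ?c \<omega> * ?P \<omega>) \<omega> + ?E (\<lambda>\<omega>. ?b \<omega> * W \<omega>) \<omega>
      = ?E (\<lambda>\<omega>. (?a \<omega> + ?c \<omega> * ?P \<omega>) + ?b \<omega> * W \<omega>) \<omega>"
    by (rule nn_cond_exp_sum) simp_all
  have r2: "AE \<omega> in M. ?E ?a \<omega> + ?E (\<lambda>\<omega>. ?c \<omega> * ?P \<omega>) \<omega> = ?E (\<lambda>\<omega>. ?a \<omega> + ?c \<omega> * ?P \<omega>) \<omega>"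
    by (rule nn_cond_exp_sum) simp_all
  have r3: "AE \<omega> in M. ?c \<omega> * ?E ?P \<omega> = ?E (\<lambda>\<omega>. ?c \<omega> * ?P \<omega>) \<omega>"
    by (rule nn_cond_exp_prod) simp_all
  have r4: "AE \<omega> in M. ?b \<omega> * ?E W \<omega> = ?E (\<lambda>\<omega>. ?b \<omega> * W \<omega>) \<omega>"
    by (rule nn_cond_exp_prod) simp_all
  have r5: "AE \<omega> in M. ?a \<omega> = ?E ?a \<omega>"
    by (rule nn_cond_exp_F_meas) simp
  show ?thesis using m l1 l2 r1 r2 r3 r4 r5 PN tail' G(1)
  proof eventually_elim
    case (elim \<omega>)
    note nn = coeff[OF elim(11)]
    have "?c \<omega> * ?E ?N \<omega> + ?E ?Z \<omega> = ?E (\<lambda>\<omega>. ?Z \<omega> + ?c \<omega> * ?N \<omega>) \<omega>"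
      by (simp only: elim(2)[symmetric] elim(3) add.commute)
    also have "\<dots> \<le> ?E (\<lambda>\<omega>. (?a \<omega> + ?c \<omega> * ?P \<omega>) + ?b \<omega> * W \<omega>) \<omega>" by (rule elim(1))
    also have "\<dots> = (?a \<omega> + ?c \<omega> * ?E ?P \<omega>) + ?b \<omega> * ?E W \<omega>"
      by (simp only: elim(4)[symmetric] elim(5)[symmetric] elim(6) elim(7) elim(8)[symmetric])
    also have "\<dots> = ?c \<omega> * ?E ?N \<omega> + (?a \<omega> + ?b \<omega> * ?E W \<omega>)"
      using elim(9) by (simp only: ac_simps)
    finally have "?E ?Z \<omega> \<le> ?a \<omega> + ?b \<omega> * ?E W \<omega>"
      using elim(9) by (subst (asm) ennreal_add_left_cancel_le) (auto simp: ennreal_mult_eq_top_iff)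
    also have "\<dots> \<le> ?a \<omega> + ?b \<omega> * 2" using elim(10) by (intro add_left_mono mult_left_mono) auto
    also have "\<dots> = ennreal (A (K \<omega>) + 2 * B (K \<omega>))"
      using nn by (simp add: ennreal_mult ennreal_plus mult.commute)
    also have "\<dots> \<le> ennreal (v (K \<omega>))" using nn by (intro ennreal_leI) simp
    finally show ?case .
  qed
qed

end

lemma measurable_truncation:
  fixes X K :: "'a \<Rightarrow> real" and u :: real
  assumes [measurable]: "X \<in> borel_measurable M" "K \<in> borel_measurable M"
  shows "(\<lambda>\<omega>. if X \<omega> \<le> K \<omega> * u then X \<omega> else 0) \<in> borel_measurable M"
  by measurable

context finite_measure_subalgebra begin

text \<open>
  The two pointwise bounds are used on either side of \<open>\<bar>l * K\<bar> = 1\<close>, which covers arbitrarily large values of \<open>l * K\<close>.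
\<close>

lemma nn_cond_exp_mgf_subgaussian:
  fixes X K :: "'a \<Rightarrow> real"
  assumes [measurable]: "X \<in> borel_measurable M" "K \<in> borel_measurable F"
    and K: "AE \<omega> in M. 0 \<le> K \<omega>"
    and centred: "AE \<omega> in M. real_cond_exp M F X \<omega> = 0"
    and tail: "AE \<omega> in M. nn_cond_exp M F (\<lambda>\<omega>. exp_ratio_powr 2 (X \<omega>) (K \<omega>)) \<omega> \<le> 2"
    and l: "0 \<le> l"
  shows "AE \<omega> in M. nn_cond_exp M F (\<lambda>\<omega>. ennreal (exp (l * X \<omega>))) \<omega> \<le> ennreal (exp (l\<^sup>2 / 2 * (2 * (K \<omega>)\<^sup>2)))"
proof -
  define t where "t k = (l * k)\<^sup>2" for k
  define A where "A k = (if t k \<le> 1 then exp (t k) * (1 - t k) else exp (t k / 2 + 1 / 2) / 2)" for k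
  define B where "B k = (if t k \<le> 1 then exp (t k) * t k / exp 1 else exp (t k / 2 + 1 / 2) / (2 * exp 1))" for k
  define c where "c k = (if t k \<le> 1 then l else 0)" for k
  have [measurable]: "t \<in> borel_measurable borel" unfolding t_def by measurable
  show ?thesis
  proof (rule nn_cond_exp_mgf_le[where \<theta> = "1 / 2" and G = "{0..}" and X = X and K = K
        and A = A and B = B and c = c and v = "\<lambda>k. exp (l\<^sup>2 / 2 * (2 * k\<^sup>2))"])
    show "A \<in> borel_measurable borel" "B \<in> borel_measurable borel" "c \<in> borel_measurable borel"
      unfolding A_def B_def c_def by measurable
    fix \<omega> assume "K \<omega> \<in> {0..}" "K \<omega> = 0 \<Longrightarrow> X \<omega> = 0"
    then have k: "0 \<le> K \<omega>" "K \<omega> = 0 \<Longrightarrow> X \<omega> = 0" by simp_all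
    note bounds = exp_mult_le_subgaussian_scale[OF k(1) l k(2)]
    show "exp (l * X \<omega>) \<le> A (K \<omega>) + c (K \<omega>) * X \<omega> + B (K \<omega>) * exp ((\<bar>X \<omega>\<bar> / K \<omega>) powr (1 / (1 / 2)))"
    proof (cases "t (K \<omega>) \<le> 1")
      case True
      then show ?thesis using bounds(1) by (simp add: A_def B_def c_def t_def)
    next
      case False
      then show ?thesis using bounds(2) by (simp add: A_def B_def c_def t_def)
    qed
  next
    fix k :: real
    have e: "2 \<le> exp (1 :: real)" using exp_ge_add_one_self[of 1] by simp
    have v: "exp (l\<^sup>2 / 2 * (2 * k\<^sup>2)) = exp (t k)" by (simp add: t_def power_mult_distrib)
    have t: "0 \<le> t k" by (simp add: t_def)
    have "A k + 2 * B k \<le> exp (t k)"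
    proof (cases "t k \<le> 1")
      case True
      have "2 * (exp (t k) * t k / exp 1) = exp (t k) * t k * (2 / exp 1)" by simp
      also have "\<dots> \<le> exp (t k) * t k * 1" using t e by (intro mult_left_mono) auto
      finally show ?thesis using True by (simp add: A_def B_def algebra_simps)
    next
      case False
      define q where "q = exp (t k / 2 + 1 / 2)"
      have "q * (1 / exp 1) \<le> q * (1 / 2)"
        using e by (intro mult_left_mono) (simp_all add: q_def field_simps)
      moreover have "A k = q / 2" "2 * B k = q * (1 / exp 1)"
        using False by (simp_all add: A_def B_def q_def)
      ultimately have "A k + 2 * B k \<le> exp (t k / 2 + 1 / 2)" unfolding q_def by linarith
      also have "\<dots> \<le> exp (t k)" using False by simp
      finally show ?thesis .
    qed
    moreover have "0 \<le> A k" "0 \<le> B k" "0 \<le> c k" using t l by (simp_all add: A_def B_def c_def)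
    ultimately show "0 \<le> A k \<and> 0 \<le> B k \<and> 0 \<le> c k \<and> A k + 2 * B k \<le> exp (l\<^sup>2 / 2 * (2 * k\<^sup>2))"
      unfolding v by blast
  qed (use assms in simp_all)
qed

text \<open>
  Since \<open>a = b\<^sup>2\<close>, the bound is \<open>1 + u\<^sup>2 / 2 \<le> exp (u\<^sup>2 / 2)\<close> for \<open>u = l * b * K\<close>, while \<open>u \<le> 1\<close> keeps the constant
  coefficient \<open>1 - u\<^sup>2 / 2\<close> nonnegative.
\<close>

lemma nn_cond_exp_mgf_light_tail:
  fixes X K :: "'a \<Rightarrow> real" and \<theta> :: real
  defines "a \<equiv> (4 * \<theta>) powr (2 * \<theta>) * (exp 1)\<^sup>2" and "b \<equiv> (4 * \<theta>) powr \<theta> * exp 1"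
  assumes [measurable]: "X \<in> borel_measurable M" "K \<in> borel_measurable F"
    and th: "1 / 2 < \<theta>" "\<theta> \<le> 1"
    and K: "AE \<omega> in M. 0 \<le> K \<omega>" "AE \<omega> in M. K \<omega> \<le> m"
    and centred: "AE \<omega> in M. real_cond_exp M F X \<omega> = 0"
    and tail: "AE \<omega> in M. nn_cond_exp M F (\<lambda>\<omega>. exp_ratio_powr (1 / \<theta>) (X \<omega>) (K \<omega>)) \<omega> \<le> 2"
    and l: "0 \<le> l" "l * (b * m) \<le> 1"
  shows "AE \<omega> in M. nn_cond_exp M F (\<lambda>\<omega>. ennreal (exp (l * X \<omega>))) \<omega> \<le> ennreal (exp (l\<^sup>2 / 2 * (a * (K \<omega>)\<^sup>2)))"
proof (rule nn_cond_exp_mgf_le[where \<theta> = \<theta> and G = "{0..m}" and X = X and K = K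
      and A = "\<lambda>k. 1 - (l * b * k)\<^sup>2 / 2" and B = "\<lambda>k. (l * b * k)\<^sup>2 / 2"
      and c = "\<lambda>k. l" and v = "\<lambda>k. exp (l\<^sup>2 / 2 * (a * k\<^sup>2))"])
  have b: "b > 0" using th by (simp add: b_def)
  have small: "l * b * k \<le> 1" if "k \<in> {0..m}" for k
  proof -
    have "l * b * k \<le> l * b * m" using that l b by (intro mult_left_mono) auto
    then show ?thesis using l by (simp add: mult.assoc)
  qed
  fix k assume k: "k \<in> {0..m}"
  have "a = b\<^sup>2" by (simp add: a_def b_def power2_eq_square powr_add[symmetric])
  then have v: "l\<^sup>2 / 2 * (a * k\<^sup>2) = (l * b * k)\<^sup>2 / 2" by (simp add: power_mult_distrib)
  have "(l * b * k)\<^sup>2 \<le> 1" using small[OF k] k l b by (intro power_le_one) auto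
  then have "0 \<le> 1 - (l * b * k)\<^sup>2 / 2" by simp
  moreover have "1 - (l * b * k)\<^sup>2 / 2 + 2 * ((l * b * k)\<^sup>2 / 2) \<le> exp ((l * b * k)\<^sup>2 / 2)"
    using exp_ge_add_one_self[of "(l * b * k)\<^sup>2 / 2"] by linarith
  moreover have "0 \<le> (l * b * k)\<^sup>2 / 2" by simp
  ultimately show "0 \<le> 1 - (l * b * k)\<^sup>2 / 2 \<and> 0 \<le> (l * b * k)\<^sup>2 / 2 \<and> 0 \<le> l \<and>
      1 - (l * b * k)\<^sup>2 / 2 + 2 * ((l * b * k)\<^sup>2 / 2) \<le> exp (l\<^sup>2 / 2 * (a * k\<^sup>2))"
    unfolding v using l(1) by blast
next
  fix \<omega> assume k: "K \<omega> \<in> {0..m}" "K \<omega> = 0 \<Longrightarrow> X \<omega> = 0"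
  have "l * b * K \<omega> \<le> l * b * m" using k l th by (intro mult_left_mono) (auto simp: b_def)
  then have "l * b * K \<omega> \<le> 1" using l by (simp add: mult.assoc)
  then show "exp (l * X \<omega>) \<le> 1 - (l * b * K \<omega>)\<^sup>2 / 2 + l * X \<omega> + (l * b * K \<omega>)\<^sup>2 / 2 * exp ((\<bar>X \<omega>\<bar> / K \<omega>) powr (1 / \<theta>))"
    unfolding b_def using th k l by (intro exp_mult_le_light_tail) auto
qed (use assms in simp_all)

text \<open>
  The factor \<open>2 powr (2 * \<theta> + 1)\<close> is twice the factor in the pointwise bound, as the exponential has
  conditional expectation at most 2.
\<close>

lemma nn_cond_exp_mgf_truncated:
  fixes X K :: "'a \<Rightarrow> real" and \<theta> L :: real
  defines "T \<equiv> (\<lambda>\<omega>. if X \<omega> \<le> K \<omega> * L powr \<theta> then X \<omega> else 0)"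
  defines "b \<equiv> 2 * L powr (\<theta> - 1)"
  assumes [measurable]: "X \<in> borel_measurable M" "K \<in> borel_measurable F"
    and th: "1 < \<theta>" and L: "0 < L"
    and a: "2 powr (2 * \<theta> + 1) * Gamma (2 * \<theta> + 1) \<le> a"
    and K: "AE \<omega> in M. 0 \<le> K \<omega>" "AE \<omega> in M. K \<omega> \<le> m"
    and centred: "AE \<omega> in M. real_cond_exp M F X \<omega> = 0"
    and tail: "AE \<omega> in M. nn_cond_exp M F (\<lambda>\<omega>. exp_ratio_powr (1 / \<theta>) (X \<omega>) (K \<omega>)) \<omega> \<le> 2"
    and l: "0 \<le> l" "l * (b * m) \<le> 1"
  shows "AE \<omega> in M. nn_cond_exp M F (\<lambda>\<omega>. ennreal (exp (l * T \<omega>))) \<omega> \<le> ennreal (exp (l\<^sup>2 / 2 * (a * (K \<omega>)\<^sup>2)))"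
proof -
  have [measurable]: "K \<in> borel_measurable M" by (rule measurable_from_subalg[OF subalg]) simp
  have T: "T \<in> borel_measurable M" unfolding T_def by (rule measurable_truncation) simp_all
  define G where "G = 2 powr (2 * \<theta>) * Gamma (2 * \<theta> + 1)"
  have G: "0 \<le> G" using th Gamma_real_pos[of "2 * \<theta> + 1"] by (simp add: G_def)
  show ?thesis
  proof (rule nn_cond_exp_mgf_le[where \<theta> = \<theta> and G = "{0..m}" and X = X and K = K
      and A = "\<lambda>k. 1" and B = "\<lambda>k. (l * k)\<^sup>2 / 2 * G"
      and c = "\<lambda>k. l" and v = "\<lambda>k. exp (l\<^sup>2 / 2 * (a * k\<^sup>2))"])
    fix k assume k: "k \<in> {0..m}"
    have "2 * ((l * k)\<^sup>2 / 2 * G) = l\<^sup>2 / 2 * (2 powr (2 * \<theta> + 1) * Gamma (2 * \<theta> + 1) * k\<^sup>2)"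
      by (simp add: G_def power_mult_distrib powr_add)
    also have "\<dots> \<le> l\<^sup>2 / 2 * (a * k\<^sup>2)" using a by (intro mult_left_mono mult_right_mono) auto
    finally have "1 + 2 * ((l * k)\<^sup>2 / 2 * G) \<le> exp (l\<^sup>2 / 2 * (a * k\<^sup>2))"
      using exp_ge_add_one_self[of "l\<^sup>2 / 2 * (a * k\<^sup>2)"] by linarith
    moreover have "0 \<le> (l * k)\<^sup>2 / 2 * G" using G by simp
    ultimately show "0 \<le> (1::real) \<and> 0 \<le> (l * k)\<^sup>2 / 2 * G \<and> 0 \<le> l \<and>
        1 + 2 * ((l * k)\<^sup>2 / 2 * G) \<le> exp (l\<^sup>2 / 2 * (a * k\<^sup>2))"
      using l(1) zero_le_one by blast
  next
    fix \<omega> assume k: "K \<omega> \<in> {0..m}" "K \<omega> = 0 \<Longrightarrow> X \<omega> = 0"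
    have "l * b * K \<omega> \<le> l * b * m" using k l by (intro mult_left_mono) (auto simp: b_def)
    then have "l * b * K \<omega> \<le> 1" using l by (simp add: mult.assoc)
    then show "exp (l * T \<omega>) \<le> 1 + l * X \<omega> + (l * K \<omega>)\<^sup>2 / 2 * G * exp ((\<bar>X \<omega>\<bar> / K \<omega>) powr (1 / \<theta>))"
      unfolding b_def T_def G_def using th k l L by (intro exp_truncated_mult_le) auto
  next
    show "T \<in> borel_measurable M" by (rule T)
  qed (use assms in simp_all)
qed

text \<open>
  Exceeding \<open>K * L powr \<theta>\<close> forces the exponential above \<open>exp L\<close>, so Markov's inequality applies. Where
  \<open>K = 0\<close> the exponential is infinite as soon as \<open>X \<noteq> 0\<close>.
\<close>

lemma measure_truncated_neq_le:
  fixes X K :: "'a \<Rightarrow> real" and \<theta> L :: real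
  assumes [measurable]: "X \<in> borel_measurable M" "K \<in> borel_measurable F"
    and th: "0 < \<theta>" and L: "0 < L"
    and K: "AE \<omega> in M. 0 \<le> K \<omega>"
    and tail: "AE \<omega> in M. nn_cond_exp M F (\<lambda>\<omega>. exp_ratio_powr (1 / \<theta>) (X \<omega>) (K \<omega>)) \<omega> \<le> 2"
  shows "measure M {\<omega> \<in> space M. X \<omega> \<noteq> (if X \<omega> \<le> K \<omega> * L powr \<theta> then X \<omega> else 0)}
    \<le> 2 * exp (- L) * measure M (space M)"
proof -
  have [measurable]: "K \<in> borel_measurable M" by (rule measurable_from_subalg[OF subalg]) simp
  define W where "W \<omega> = exp_ratio_powr (1 / \<theta>) (X \<omega>) (K \<omega>)" for \<omega>
  have [measurable]: "W \<in> borel_measurable M" unfolding W_def by simp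
  have "emeasure M {\<omega> \<in> space M. X \<omega> \<noteq> (if X \<omega> \<le> K \<omega> * L powr \<theta> then X \<omega> else 0)}
      \<le> emeasure M {\<omega> \<in> space M. 1 \<le> ennreal (exp (- L)) * W \<omega>}"
  proof (rule emeasure_mono_AE)
    show "AE \<omega> in M. \<omega> \<in> {\<omega> \<in> space M. X \<omega> \<noteq> (if X \<omega> \<le> K \<omega> * L powr \<theta> then X \<omega> else 0)}
        \<longrightarrow> \<omega> \<in> {\<omega> \<in> space M. 1 \<le> ennreal (exp (- L)) * W \<omega>}"
      using K
    proof (eventually_elim, safe)
      fix \<omega> assume k: "0 \<le> K \<omega>" and neq: "X \<omega> \<noteq> (if X \<omega> \<le> K \<omega> * L powr \<theta> then X \<omega> else 0)"
      then have x: "K \<omega> * L powr \<theta> < X \<omega>" "X \<omega> \<noteq> 0" by (auto split: if_splits)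
      show "1 \<le> ennreal (exp (- L)) * W \<omega>"
      proof (cases "K \<omega> = 0")
        case True
        then have "W \<omega> = \<top>" using x by (simp add: W_def exp_ratio_powr_def)
        then show ?thesis by (simp add: ennreal_mult_top)
      next
        case False
        then have "L powr \<theta> \<le> \<bar>X \<omega>\<bar> / K \<omega>" using k x by (simp add: field_simps)
        then have "(L powr \<theta>) powr (1 / \<theta>) \<le> (\<bar>X \<omega>\<bar> / K \<omega>) powr (1 / \<theta>)" using th by (intro powr_mono2) auto
        then have "L \<le> (\<bar>X \<omega>\<bar> / K \<omega>) powr (1 / \<theta>)" using th L by (simp add: powr_powr)
        then show ?thesis using False
          by (simp add: W_def exp_ratio_powr_def ennreal_mult[symmetric] mult_exp_exp)
      qed
    qed
  qed simp
  also have "\<dots> \<le> ennreal (exp (- L)) * (\<integral>\<^sup>+\<omega>. W \<omega> \<partial>M)"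
    by (rule emeasure_one_le_mult_le) simp
  also have "\<dots> \<le> ennreal (exp (- L)) * (2 * emeasure M (space M))"
    unfolding W_def using tail by (intro mult_left_mono exp_ratio_powr_integral_le) simp_all
  also have "\<dots> = ennreal (2 * exp (- L) * measure M (space M))"
    by (simp add: emeasure_eq_measure ennreal_mult mult_ac)
  finally show ?thesis by (simp add: emeasure_eq_measure ennreal_le_iff)
qed

end

section \<open>From moment generating functions to self-normalised tail bounds\<close>

text \<open>
  Given a sub-Gaussian bound on the conditional moment generating function of \<open>T\<close> for all \<open>l\<close> with
  \<open>l * c \<le> 1\<close>, the maximal inequality applies to the sums of \<open>l * T i - l\<^sup>2 / 2 * a * (K (i - 1))\<^sup>2\<close>, and
  replacing \<open>X\<close> by \<open>T\<close> costs at most \<open>\<eta>\<close>. A deterministic bound on the variance proxy is inserted with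
  \<open>l = lam\<close>. If the variance proxy is bounded by \<open>\<alpha>\<close> times the sum plus \<open>\<beta>\<close>, then \<open>l = 2 * lam\<close> works: the
  variance term consumes \<open>2 * lam\<^sup>2 * \<alpha>\<close> of the coefficient \<open>2 * lam\<close> of the sum, and
  \<open>lam * 2 * \<alpha> \<le> 1\<close> leaves at least \<open>lam\<close>. The same inequality makes \<open>2 * lam\<close> admissible when
  \<open>c \<le> \<alpha>\<close>.
\<close>

lemma tail_bounds_of_mgf:
  fixes M :: "'a measure" and F :: "nat \<Rightarrow> 'a measure" and X T K :: "nat \<Rightarrow> 'a \<Rightarrow> real" and a c \<eta> :: real
  assumes ps: "prob_space M" and fil: "filtration (space M) F" and sub: "\<And>i. subalgebra M (F i)"
    and X: "\<And>i. X i \<in> borel_measurable M"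
    and T: "\<And>i. T i \<in> borel_measurable (F i)" and K: "\<And>i. K i \<in> borel_measurable (F i)"
    and mgf: "\<And>l i. 0 \<le> l \<Longrightarrow> l * c \<le> 1 \<Longrightarrow> i \<in> {1..n} \<Longrightarrow> AE \<omega> in M.
      nn_cond_exp M (F (i - 1)) (\<lambda>\<omega>. ennreal (exp (l * T i \<omega>))) \<omega> \<le> ennreal (exp (l\<^sup>2 / 2 * (a * (K (i - 1) \<omega>)\<^sup>2)))"
    and neq: "measure M (\<Union>i\<in>{1..n}. {\<omega> \<in> space M. X i \<omega> \<noteq> T i \<omega>}) \<le> \<eta>"
  shows "0 \<le> lam \<Longrightarrow> lam * c \<le> 1 \<Longrightarrow>
      measure M (\<Union>k\<in>{1..n}. {\<omega> \<in> space M. x \<le> (\<Sum>i=1..k. X i \<omega>) \<and>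
          (\<Sum>i=1..k. a * (K (i - 1) \<omega>)\<^sup>2) \<le> \<beta>}) \<le> exp (- lam * x + lam\<^sup>2 / 2 * \<beta>) + \<eta>"
    and "0 \<le> x \<Longrightarrow> c \<le> \<alpha> \<Longrightarrow> 0 \<le> lam \<Longrightarrow> lam * (2 * \<alpha>) \<le> 1 \<Longrightarrow>
      measure M (\<Union>k\<in>{1..n}. {\<omega> \<in> space M. x \<le> (\<Sum>i=1..k. X i \<omega>) \<and>
          (\<Sum>i=1..k. a * (K (i - 1) \<omega>)\<^sup>2) \<le> \<alpha> * (\<Sum>i=1..k. X i \<omega>) + \<beta>}) \<le> exp (- lam * x + 2 * lam\<^sup>2 * \<beta>) + \<eta>"
proof -
  interpret prob_space M by fact
  have [measurable]: "X i \<in> borel_measurable M" for i by (rule X)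
  have [measurable]: "T i \<in> borel_measurable M" for i by (rule measurable_from_subalg[OF sub T])
  have [measurable]: "K i \<in> borel_measurable M" for i by (rule measurable_from_subalg[OF sub K])
  have core: "measure M (\<Union>k\<in>{1..n}. {\<omega> \<in> space M. P (\<Sum>i=1..k. X i \<omega>) (\<Sum>i=1..k. a * (K (i - 1) \<omega>)\<^sup>2)})
      \<le> exp (- r) + \<eta>"
    if l: "0 \<le> l" "l * c \<le> 1" and P: "\<And>u v. P u v \<Longrightarrow> r \<le> l * u - l\<^sup>2 / 2 * v" for P l r
  proof -
    define V where "V i \<omega> = l\<^sup>2 / 2 * (a * (K (i - 1) \<omega>)\<^sup>2)" for i \<omega>
    define Y where "Y i \<omega> = l * T i \<omega> - V i \<omega>" for i \<omega>
    have VF: "V i \<in> borel_measurable (F (i - 1))" for i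
    proof -
      note [measurable] = K[of "i - 1"]
      show ?thesis unfolding V_def by measurable
    qed
    have Y: "Y i \<in> borel_measurable (F i)" for i
    proof -
      have [measurable]: "V i \<in> borel_measurable (F i)"
        by (rule measurable_filtration_mono[OF fil _ VF]) simp
      note [measurable] = T[of i]
      show ?thesis unfolding Y_def by simp
    qed
    have cond: "AE \<omega> in M. nn_cond_exp M (F (i - 1)) (\<lambda>\<omega>. ennreal (exp (Y i \<omega>))) \<omega> \<le> 1" if i: "i \<in> {1..n}" for i
    proof -
      interpret S: finite_measure_subalgebra M "F (i - 1)" by unfold_locales (rule sub)
      note [measurable] = VF[of i]
      have "AE \<omega> in M. ennreal (exp (- V i \<omega>)) * nn_cond_exp M (F (i - 1)) (\<lambda>\<omega>. ennreal (exp (l * T i \<omega>))) \<omega>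
          = nn_cond_exp M (F (i - 1)) (\<lambda>\<omega>. ennreal (exp (- V i \<omega>)) * ennreal (exp (l * T i \<omega>))) \<omega>"
        by (rule S.nn_cond_exp_prod; measurable)
      moreover have "(\<lambda>\<omega>. ennreal (exp (- V i \<omega>)) * ennreal (exp (l * T i \<omega>))) = (\<lambda>\<omega>. ennreal (exp (Y i \<omega>)))"
        by (simp add: Y_def ennreal_mult[symmetric] mult_exp_exp)
      ultimately have "AE \<omega> in M. ennreal (exp (- V i \<omega>)) * nn_cond_exp M (F (i - 1)) (\<lambda>\<omega>. ennreal (exp (l * T i \<omega>))) \<omega>
          = nn_cond_exp M (F (i - 1)) (\<lambda>\<omega>. ennreal (exp (Y i \<omega>))) \<omega>"
        by (simp only:)
      then show ?thesis using mgf[OF l i]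
      proof eventually_elim
        case (elim \<omega>)
        have "ennreal (exp (- V i \<omega>)) * nn_cond_exp M (F (i - 1)) (\<lambda>\<omega>. ennreal (exp (l * T i \<omega>))) \<omega>
            \<le> ennreal (exp (- V i \<omega>)) * ennreal (exp (V i \<omega>))"
          using elim(2) unfolding V_def by (rule mult_left_mono) simp
        also have "\<dots> = 1" by (simp add: ennreal_mult[symmetric] mult_exp_exp)
        finally show ?case unfolding elim(1)[symmetric] .
      qed
    qed
    let ?E = "\<Union>k\<in>{1..n}. {\<omega> \<in> space M. r \<le> (\<Sum>i=1..k. Y i \<omega>)}"
    let ?N = "\<Union>i\<in>{1..n}. {\<omega> \<in> space M. X i \<omega> \<noteq> T i \<omega>}"
    have YM[measurable]: "Y i \<in> borel_measurable M" for i by (rule measurable_from_subalg[OF sub Y])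
    have sets: "?E \<in> sets M" "?N \<in> sets M" by measurable
    have "(\<Union>k\<in>{1..n}. {\<omega> \<in> space M. P (\<Sum>i=1..k. X i \<omega>) (\<Sum>i=1..k. a * (K (i - 1) \<omega>)\<^sup>2)}) \<subseteq> ?E \<union> ?N"
    proof
      fix \<omega> assume "\<omega> \<in> (\<Union>k\<in>{1..n}. {\<omega> \<in> space M. P (\<Sum>i=1..k. X i \<omega>) (\<Sum>i=1..k. a * (K (i - 1) \<omega>)\<^sup>2)})"
      then obtain k where k: "k \<in> {1..n}" "\<omega> \<in> space M" "P (\<Sum>i=1..k. X i \<omega>) (\<Sum>i=1..k. a * (K (i - 1) \<omega>)\<^sup>2)"
        by blast
      show "\<omega> \<in> ?E \<union> ?N"
      proof (cases "\<omega> \<in> ?N")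
        case False
        then have "(\<Sum>i=1..k. X i \<omega>) = (\<Sum>i=1..k. T i \<omega>)" using k by (intro sum.cong) auto
        then have "r \<le> l * (\<Sum>i=1..k. T i \<omega>) - l\<^sup>2 / 2 * (\<Sum>i=1..k. a * (K (i - 1) \<omega>)\<^sup>2)"
          using P[OF k(3)] by simp
        also have "\<dots> = (\<Sum>i=1..k. Y i \<omega>)" by (simp only: Y_def V_def sum_subtractf sum_distrib_left)
        finally show ?thesis using k by blast
      qed simp
    qed
    then have "measure M (\<Union>k\<in>{1..n}. {\<omega> \<in> space M. P (\<Sum>i=1..k. X i \<omega>) (\<Sum>i=1..k. a * (K (i - 1) \<omega>)\<^sup>2)})
        \<le> measure M (?E \<union> ?N)"
      using sets by (intro finite_measure_mono) auto
    also have "\<dots> \<le> measure M ?E + measure M ?N" using sets by (rule measure_Un_le)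
    also have "\<dots> \<le> exp (- r) + \<eta>"
      using maximal_inequality[OF ps fil sub Y cond] neq by (intro add_mono) auto
    finally show ?thesis .
  qed
  show "measure M (\<Union>k\<in>{1..n}. {\<omega> \<in> space M. x \<le> (\<Sum>i=1..k. X i \<omega>) \<and>
          (\<Sum>i=1..k. a * (K (i - 1) \<omega>)\<^sup>2) \<le> \<beta>}) \<le> exp (- lam * x + lam\<^sup>2 / 2 * \<beta>) + \<eta>"
    if "0 \<le> lam" "lam * c \<le> 1"
  proof -
    have "lam * x - lam\<^sup>2 / 2 * \<beta> \<le> lam * u - lam\<^sup>2 / 2 * v" if "x \<le> u \<and> v \<le> \<beta>" for u v
      using that \<open>0 \<le> lam\<close> by (intro diff_mono mult_left_mono) auto
    from core[OF that, of "\<lambda>u v. x \<le> u \<and> v \<le> \<beta>", OF this] show ?thesis by (simp add: algebra_simps)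
  qed
  show "measure M (\<Union>k\<in>{1..n}. {\<omega> \<in> space M. x \<le> (\<Sum>i=1..k. X i \<omega>) \<and>
          (\<Sum>i=1..k. a * (K (i - 1) \<omega>)\<^sup>2) \<le> \<alpha> * (\<Sum>i=1..k. X i \<omega>) + \<beta>}) \<le> exp (- lam * x + 2 * lam\<^sup>2 * \<beta>) + \<eta>"
    if x: "0 \<le> x" and \<alpha>: "c \<le> \<alpha>" and lam: "0 \<le> lam" "lam * (2 * \<alpha>) \<le> 1"
  proof -
    have l: "0 \<le> 2 * lam" "2 * lam * c \<le> 1"
      using lam mult_left_mono[OF \<alpha> lam(1)] by auto
    have "lam * x - 2 * lam\<^sup>2 * \<beta> \<le> 2 * lam * u - (2 * lam)\<^sup>2 / 2 * v" if uv: "x \<le> u \<and> v \<le> \<alpha> * u + \<beta>" for u v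
    proof -
      have "lam * u * (lam * (2 * \<alpha>)) \<le> lam * u * 1" using uv x lam by (intro mult_left_mono) auto
      moreover have "lam\<^sup>2 * v \<le> lam\<^sup>2 * (\<alpha> * u + \<beta>)" using uv by (intro mult_left_mono) auto
      moreover have "lam * x \<le> lam * u" using uv lam by (intro mult_left_mono) auto
      ultimately show ?thesis by (simp add: algebra_simps power2_eq_square)
    qed
    from core[OF l, of "\<lambda>u v. x \<le> u \<and> v \<le> \<alpha> * u + \<beta>", OF this] show ?thesis by (simp add: algebra_simps)
  qed
qed

lemma in_zero_to_recip_iff:
  assumes "0 \<le> c"
  shows "l \<in> zero_to_recip c \<longleftrightarrow> 0 \<le> l \<and> l * c \<le> 1"
  using assms by (auto simp: zero_to_recip_def field_simps)

text \<open>
  The form in which the bounds are needed when the scales \<open>K\<close> have a deterministic bound. For \<open>n = 0\<close> the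
  constant \<open>c\<close>, which involves a maximum over an empty set, may be negative; then the union is empty.
\<close>

lemma tail_bounds_zero_to_recip:
  fixes M :: "'a measure" and F :: "nat \<Rightarrow> 'a measure" and X T K :: "nat \<Rightarrow> 'a \<Rightarrow> real" and a c \<eta> :: real
  assumes ps: "prob_space M" and fil: "filtration (space M) F" and sub: "\<And>i. subalgebra M (F i)"
    and X: "\<And>i. X i \<in> borel_measurable M"
    and T: "\<And>i. T i \<in> borel_measurable (F i)" and K: "\<And>i. K i \<in> borel_measurable (F i)"
    and c: "n \<noteq> 0 \<Longrightarrow> 0 \<le> c"
    and mgf: "\<And>l i. 0 \<le> l \<Longrightarrow> l * c \<le> 1 \<Longrightarrow> i \<in> {1..n} \<Longrightarrow> AE \<omega> in M.
      nn_cond_exp M (F (i - 1)) (\<lambda>\<omega>. ennreal (exp (l * T i \<omega>))) \<omega> \<le> ennreal (exp (l\<^sup>2 / 2 * (a * (K (i - 1) \<omega>)\<^sup>2)))"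
    and neq: "measure M (\<Union>i\<in>{1..n}. {\<omega> \<in> space M. X i \<omega> \<noteq> T i \<omega>}) \<le> \<eta>"
  shows "(\<forall>x \<beta> \<alpha> lam. 0 \<le> x \<and> 0 \<le> \<beta> \<and> c \<le> \<alpha> \<and> lam \<in> zero_to_recip (2 * \<alpha>) \<longrightarrow>
           measure M (\<Union>k\<in>{1..n}. {\<omega> \<in> space M. x \<le> (\<Sum>i=1..k. X i \<omega>) \<and>
               (\<Sum>i=1..k. a * (K (i - 1) \<omega>)\<^sup>2) \<le> \<alpha> * (\<Sum>i=1..k. X i \<omega>) + \<beta>})
             \<le> exp (- lam * x + 2 * lam\<^sup>2 * \<beta>) + \<eta>) \<and>
        (\<forall>x \<beta> lam. 0 \<le> x \<and> 0 \<le> \<beta> \<and> lam \<in> zero_to_recip c \<longrightarrow>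
           measure M (\<Union>k\<in>{1..n}. {\<omega> \<in> space M. x \<le> (\<Sum>i=1..k. X i \<omega>) \<and>
               (\<Sum>i=1..k. a * (K (i - 1) \<omega>)\<^sup>2) \<le> \<beta>})
             \<le> exp (- lam * x + lam\<^sup>2 / 2 * \<beta>) + \<eta>)"
proof (cases "n = 0")
  case True
  then have "0 \<le> \<eta>" using neq by simp
  then show ?thesis using True by (simp add: add_nonneg_nonneg)
next
  case False
  note bounds = tail_bounds_of_mgf[OF ps fil sub X T K mgf neq]
  show ?thesis
  proof (intro conjI allI impI; elim conjE)
    fix x \<beta> \<alpha> lam :: real
    assume *: "0 \<le> x" "c \<le> \<alpha>" "lam \<in> zero_to_recip (2 * \<alpha>)"
    then have "0 \<le> lam" "lam * (2 * \<alpha>) \<le> 1" using in_zero_to_recip_iff[of "2 * \<alpha>" lam] c[OF False] by auto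
    with * show "measure M (\<Union>k\<in>{1..n}. {\<omega> \<in> space M. x \<le> (\<Sum>i=1..k. X i \<omega>) \<and>
               (\<Sum>i=1..k. a * (K (i - 1) \<omega>)\<^sup>2) \<le> \<alpha> * (\<Sum>i=1..k. X i \<omega>) + \<beta>})
             \<le> exp (- lam * x + 2 * lam\<^sup>2 * \<beta>) + \<eta>"
      by (intro bounds(2)) assumption+
  next
    fix x \<beta> lam :: real
    assume "lam \<in> zero_to_recip c"
    then have "0 \<le> lam" "lam * c \<le> 1" using in_zero_to_recip_iff[of c lam] c[OF False] by auto
    then show "measure M (\<Union>k\<in>{1..n}. {\<omega> \<in> space M. x \<le> (\<Sum>i=1..k. X i \<omega>) \<and>
               (\<Sum>i=1..k. a * (K (i - 1) \<omega>)\<^sup>2) \<le> \<beta>})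
             \<le> exp (- lam * x + lam\<^sup>2 / 2 * \<beta>) + \<eta>"
      by (intro bounds(1)) assumption+
  qed
qed

theorem theorem11:
  fixes M :: "'a measure" and F :: "nat \<Rightarrow> 'a measure"
    and \<xi> K :: "nat \<Rightarrow> 'a \<Rightarrow> real"
    and n :: nat and \<theta> :: real and m :: "nat \<Rightarrow> real"
  assumes "prob_space M"
    and "filtration (space M) F"
    and "\<And>i. subalgebra M (F i)"
    and "\<And>i. \<xi> i \<in> borel_measurable (F i)"
    and "\<And>i. K i \<in> borel_measurable (F i)"
    and "1 / 2 \<le> \<theta>"
    and "\<And>i. i \<in> {1..n} \<Longrightarrow> AE \<omega> in M. 0 \<le> K (i - 1) \<omega>"
    and "\<And>i. i \<in> {1..n} \<Longrightarrow> AE \<omega> in M. real_cond_exp M (F (i - 1)) (\<xi> i) \<omega> = 0"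
    and "\<And>i. i \<in> {1..n} \<Longrightarrow>
           AE \<omega> in M. nn_cond_exp M (F (i - 1))
             (\<lambda>\<omega>. exp_ratio_powr (1 / \<theta>) (\<xi> i \<omega>) (K (i - 1) \<omega>)) \<omega> \<le> 2"
    and "\<And>i. 1 / 2 < \<theta> \<Longrightarrow> i \<in> {1..n} \<Longrightarrow> AE \<omega> in M. K (i - 1) \<omega> \<le> m i"
  shows "(\<theta> = 1 / 2 \<longrightarrow>
        (\<forall>x \<beta> \<alpha> lam. 0 \<le> x \<and> 0 \<le> \<beta> \<and> 0 < \<alpha> \<and> lam \<in> {0..1 / (2 * \<alpha>)} \<longrightarrow>
           measure M (\<Union>k\<in>{1..n}. {\<omega> \<in> space M.
               x \<le> (\<Sum>i=1..k. \<xi> i \<omega>) \<and>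
               (\<Sum>i=1..k. 2 * (K (i - 1) \<omega>)\<^sup>2) \<le> \<alpha> * (\<Sum>i=1..k. \<xi> i \<omega>) + \<beta>})
             \<le> exp (- lam * x + 2 * lam\<^sup>2 * \<beta>)) \<and>
        (\<forall>x \<beta> lam. 0 \<le> x \<and> 0 \<le> \<beta> \<and> 0 \<le> lam \<longrightarrow>
           measure M (\<Union>k\<in>{1..n}. {\<omega> \<in> space M.
               x \<le> (\<Sum>i=1..k. \<xi> i \<omega>) \<and>
               (\<Sum>i=1..k. 2 * (K (i - 1) \<omega>)\<^sup>2) \<le> \<beta>})
             \<le> exp (- lam * x + lam\<^sup>2 / 2 * \<beta>))) \<and>
     (\<theta> \<in> {1 / 2<..1} \<longrightarrow>
      (let a = (4 * \<theta>) powr (2 * \<theta>) * (exp 1)\<^sup>2;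
           b = (4 * \<theta>) powr \<theta> * exp 1 in
        (\<forall>x \<beta> \<alpha> lam. 0 \<le> x \<and> 0 \<le> \<beta> \<and> b * (MAX i\<in>{1..n}. m i) \<le> \<alpha> \<and>
             lam \<in> zero_to_recip (2 * \<alpha>) \<longrightarrow>
           measure M (\<Union>k\<in>{1..n}. {\<omega> \<in> space M.
               x \<le> (\<Sum>i=1..k. \<xi> i \<omega>) \<and>
               (\<Sum>i=1..k. a * (K (i - 1) \<omega>)\<^sup>2) \<le> \<alpha> * (\<Sum>i=1..k. \<xi> i \<omega>) + \<beta>})
             \<le> exp (- lam * x + 2 * lam\<^sup>2 * \<beta>)) \<and>
        (\<forall>x \<beta> lam. 0 \<le> x \<and> 0 \<le> \<beta> \<and>
             lam \<in> zero_to_recip (b * (MAX i\<in>{1..n}. m i)) \<longrightarrow>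
           measure M (\<Union>k\<in>{1..n}. {\<omega> \<in> space M.
               x \<le> (\<Sum>i=1..k. \<xi> i \<omega>) \<and>
               (\<Sum>i=1..k. a * (K (i - 1) \<omega>)\<^sup>2) \<le> \<beta>})
             \<le> exp (- lam * x + lam\<^sup>2 / 2 * \<beta>)))) \<and>
     (1 < \<theta> \<longrightarrow> (\<forall>\<delta>\<in>{0<..<1}.
      let a = (2 powr (2 * \<theta> + 1) + 2) * Gamma (2 * \<theta> + 1)
                + 2 powr (3 * \<theta>) * Gamma (3 * \<theta> + 1) / (3 * ln (real n / \<delta>) powr (\<theta> - 1));
          b = 2 * ln (real n / \<delta>) powr (\<theta> - 1) in
        (\<forall>x \<beta> \<alpha> lam. 0 \<le> x \<and> 0 \<le> \<beta> \<and> b * (MAX i\<in>{1..n}. m i) \<le> \<alpha> \<and>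
             lam \<in> zero_to_recip (2 * \<alpha>) \<longrightarrow>
           measure M (\<Union>k\<in>{1..n}. {\<omega> \<in> space M.
               x \<le> (\<Sum>i=1..k. \<xi> i \<omega>) \<and>
               (\<Sum>i=1..k. a * (K (i - 1) \<omega>)\<^sup>2) \<le> \<alpha> * (\<Sum>i=1..k. \<xi> i \<omega>) + \<beta>})
             \<le> exp (- lam * x + 2 * lam\<^sup>2 * \<beta>) + 2 * \<delta>) \<and>
        (\<forall>x \<beta> lam. 0 \<le> x \<and> 0 \<le> \<beta> \<and>
             lam \<in> zero_to_recip (b * (MAX i\<in>{1..n}. m i)) \<longrightarrow>
           measure M (\<Union>k\<in>{1..n}. {\<omega> \<in> space M.
               x \<le> (\<Sum>i=1..k. \<xi> i \<omega>) \<and>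
               (\<Sum>i=1..k. a * (K (i - 1) \<omega>)\<^sup>2) \<le> \<beta>})
             \<le> exp (- lam * x + lam\<^sup>2 / 2 * \<beta>) + 2 * \<delta>)))"
proof -
  interpret prob_space M by fact
  note fil = assms(2) and sub = assms(3)
  let ?mx = "MAX i\<in>{1..n}. m i"
  have \<xi>M: "\<xi> i \<in> borel_measurable M" for i by (rule measurable_from_subalg[OF sub assms(4)])
  have fms: "finite_measure_subalgebra M (F i)" for i by unfold_locales (rule sub)
  have K_le: "AE \<omega> in M. K (i - 1) \<omega> \<le> ?mx" if "1 / 2 < \<theta>" "i \<in> {1..n}" for i
  proof -
    have "m i \<le> ?mx" using that(2) by (intro Max_ge) auto
    then show ?thesis using assms(10)[OF that] by (auto elim!: eventually_mono)
  qed
  have mx_nonneg: "0 \<le> ?mx" if "1 / 2 < \<theta>" "n \<noteq> 0"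
  proof -
    have "1 \<in> {1..n}" using that by simp
    from assms(7)[OF this] K_le[OF that(1) this] have "AE \<omega> in M. 0 \<le> ?mx"
      by eventually_elim (rule order_trans)
    then show ?thesis by simp
  qed
  have no_trunc: "measure M (\<Union>i\<in>{1..n}. {\<omega> \<in> space M. \<xi> i \<omega> \<noteq> \<xi> i \<omega>}) \<le> 0" by simp
  show ?thesis
  proof (rule conjI[OF _ conjI]; intro impI ballI)
    assume half: "\<theta> = 1 / 2"
    have mgf: "AE \<omega> in M. nn_cond_exp M (F (i - 1)) (\<lambda>\<omega>. ennreal (exp (l * \<xi> i \<omega>))) \<omega>
        \<le> ennreal (exp (l\<^sup>2 / 2 * (2 * (K (i - 1) \<omega>)\<^sup>2)))" if l: "0 \<le> l" "l * 0 \<le> 1" and i: "i \<in> {1..n}" for l i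
    proof -
      have "AE \<omega> in M. nn_cond_exp M (F (i - 1)) (\<lambda>\<omega>. exp_ratio_powr 2 (\<xi> i \<omega>) (K (i - 1) \<omega>)) \<omega> \<le> 2"
        using assms(9)[OF i] by (simp add: half)
      then show ?thesis
        by (rule finite_measure_subalgebra.nn_cond_exp_mgf_subgaussian[OF fms \<xi>M assms(5) assms(7,8)[OF i] _ l(1)])
    qed
    note bounds = tail_bounds_of_mgf[where c = 0, OF assms(1) fil sub \<xi>M assms(4,5) mgf no_trunc, unfolded add_0_right]
    show "(\<forall>x \<beta> \<alpha> lam. 0 \<le> x \<and> 0 \<le> \<beta> \<and> 0 < \<alpha> \<and> lam \<in> {0..1 / (2 * \<alpha>)} \<longrightarrow>
           measure M (\<Union>k\<in>{1..n}. {\<omega> \<in> space M.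
               x \<le> (\<Sum>i=1..k. \<xi> i \<omega>) \<and>
               (\<Sum>i=1..k. 2 * (K (i - 1) \<omega>)\<^sup>2) \<le> \<alpha> * (\<Sum>i=1..k. \<xi> i \<omega>) + \<beta>})
             \<le> exp (- lam * x + 2 * lam\<^sup>2 * \<beta>)) \<and>
        (\<forall>x \<beta> lam. 0 \<le> x \<and> 0 \<le> \<beta> \<and> 0 \<le> lam \<longrightarrow>
           measure M (\<Union>k\<in>{1..n}. {\<omega> \<in> space M.
               x \<le> (\<Sum>i=1..k. \<xi> i \<omega>) \<and>
               (\<Sum>i=1..k. 2 * (K (i - 1) \<omega>)\<^sup>2) \<le> \<beta>})
             \<le> exp (- lam * x + lam\<^sup>2 / 2 * \<beta>))"
    proof (intro conjI allI impI; elim conjE)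
      fix x \<beta> \<alpha> lam :: real
      assume *: "0 \<le> x" "0 < \<alpha>" "lam \<in> {0..1 / (2 * \<alpha>)}"
      then have "0 \<le> \<alpha>" "0 \<le> lam" "lam * (2 * \<alpha>) \<le> 1" by (auto simp: field_simps)
      with *(1) show "measure M (\<Union>k\<in>{1..n}. {\<omega> \<in> space M. x \<le> (\<Sum>i=1..k. \<xi> i \<omega>) \<and>
               (\<Sum>i=1..k. 2 * (K (i - 1) \<omega>)\<^sup>2) \<le> \<alpha> * (\<Sum>i=1..k. \<xi> i \<omega>) + \<beta>})
             \<le> exp (- lam * x + 2 * lam\<^sup>2 * \<beta>)"
        by (intro bounds(2)) assumption+
    next
      fix x \<beta> lam :: real
      assume "0 \<le> lam"
      moreover have "lam * 0 \<le> 1" by simp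
      ultimately show "measure M (\<Union>k\<in>{1..n}. {\<omega> \<in> space M. x \<le> (\<Sum>i=1..k. \<xi> i \<omega>) \<and>
               (\<Sum>i=1..k. 2 * (K (i - 1) \<omega>)\<^sup>2) \<le> \<beta>})
             \<le> exp (- lam * x + lam\<^sup>2 / 2 * \<beta>)"
        by (intro bounds(1)) assumption+
    qed
  next
    assume "\<theta> \<in> {1 / 2<..1}"
    then have th: "1 / 2 < \<theta>" "\<theta> \<le> 1" by auto
    define a where "a = (4 * \<theta>) powr (2 * \<theta>) * (exp 1)\<^sup>2"
    define b where "b = (4 * \<theta>) powr \<theta> * exp 1"
    have mgf: "AE \<omega> in M. nn_cond_exp M (F (i - 1)) (\<lambda>\<omega>. ennreal (exp (l * \<xi> i \<omega>))) \<omega>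
        \<le> ennreal (exp (l\<^sup>2 / 2 * (a * (K (i - 1) \<omega>)\<^sup>2)))" if l: "0 \<le> l" "l * (b * ?mx) \<le> 1" and i: "i \<in> {1..n}" for l i
      unfolding a_def
      by (rule finite_measure_subalgebra.nn_cond_exp_mgf_light_tail[OF fms \<xi>M assms(5) th assms(7)[OF i]
          K_le[OF th(1) i] assms(8,9)[OF i] l[unfolded b_def]])
    have c: "0 \<le> b * ?mx" if "n \<noteq> 0" using mx_nonneg[OF th(1) that] by (simp add: b_def)
    note bounds = tail_bounds_zero_to_recip[OF assms(1) fil sub \<xi>M assms(4,5) c mgf no_trunc, unfolded add_0_right a_def b_def]
    show "let a = (4 * \<theta>) powr (2 * \<theta>) * (exp 1)\<^sup>2;
           b = (4 * \<theta>) powr \<theta> * exp 1 in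
        (\<forall>x \<beta> \<alpha> lam. 0 \<le> x \<and> 0 \<le> \<beta> \<and> b * (MAX i\<in>{1..n}. m i) \<le> \<alpha> \<and>
             lam \<in> zero_to_recip (2 * \<alpha>) \<longrightarrow>
           measure M (\<Union>k\<in>{1..n}. {\<omega> \<in> space M.
               x \<le> (\<Sum>i=1..k. \<xi> i \<omega>) \<and>
               (\<Sum>i=1..k. a * (K (i - 1) \<omega>)\<^sup>2) \<le> \<alpha> * (\<Sum>i=1..k. \<xi> i \<omega>) + \<beta>})
             \<le> exp (- lam * x + 2 * lam\<^sup>2 * \<beta>)) \<and>
        (\<forall>x \<beta> lam. 0 \<le> x \<and> 0 \<le> \<beta> \<and>
             lam \<in> zero_to_recip (b * (MAX i\<in>{1..n}. m i)) \<longrightarrow>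
           measure M (\<Union>k\<in>{1..n}. {\<omega> \<in> space M.
               x \<le> (\<Sum>i=1..k. \<xi> i \<omega>) \<and>
               (\<Sum>i=1..k. a * (K (i - 1) \<omega>)\<^sup>2) \<le> \<beta>})
             \<le> exp (- lam * x + lam\<^sup>2 / 2 * \<beta>))"
      unfolding Let_def by (rule bounds)
  next
    fix \<delta> :: real assume th: "1 < \<theta>" and "\<delta> \<in> {0<..<1}"
    then have \<delta>: "0 < \<delta>" "\<delta> < 1" and th': "1 / 2 < \<theta>" by auto
    define L where "L = ln (real n / \<delta>)"
    define a where "a = (2 powr (2 * \<theta> + 1) + 2) * Gamma (2 * \<theta> + 1)
                + 2 powr (3 * \<theta>) * Gamma (3 * \<theta> + 1) / (3 * L powr (\<theta> - 1))"
    define b where "b = 2 * L powr (\<theta> - 1)"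
    define T where "T i = (\<lambda>\<omega>. if \<xi> i \<omega> \<le> K (i - 1) \<omega> * L powr \<theta> then \<xi> i \<omega> else 0)" for i
    have L: "0 < L" if "n \<noteq> 0"
      using that \<delta> by (auto simp: L_def intro!: ln_gt_zero simp: field_simps)
    have T: "T i \<in> borel_measurable (F i)" for i
      unfolding T_def by (rule measurable_truncation[OF assms(4) measurable_filtration_mono[OF fil _ assms(5)]]) simp
    have a: "2 powr (2 * \<theta> + 1) * Gamma (2 * \<theta> + 1) \<le> a"
    proof -
      have "0 < Gamma (2 * \<theta> + 1)" "0 < Gamma (3 * \<theta> + 1)" using th by (auto intro!: Gamma_real_pos)
      then show ?thesis by (simp add: a_def algebra_simps)
    qed
    have mgf: "AE \<omega> in M. nn_cond_exp M (F (i - 1)) (\<lambda>\<omega>. ennreal (exp (l * T i \<omega>))) \<omega>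
        \<le> ennreal (exp (l\<^sup>2 / 2 * (a * (K (i - 1) \<omega>)\<^sup>2)))" if l: "0 \<le> l" "l * (b * ?mx) \<le> 1" and i: "i \<in> {1..n}" for l i
    proof -
      have "0 < L" using i by (intro L) auto
      then show ?thesis
        unfolding T_def
        by (rule finite_measure_subalgebra.nn_cond_exp_mgf_truncated[OF fms \<xi>M assms(5) th _ a assms(7)[OF i]
            K_le[OF th' i] assms(8,9)[OF i] l[unfolded b_def]])
    qed
    have c: "0 \<le> b * ?mx" if "n \<noteq> 0" using mx_nonneg[OF th' that] by (simp add: b_def)
    have trunc: "measure M (\<Union>i\<in>{1..n}. {\<omega> \<in> space M. \<xi> i \<omega> \<noteq> T i \<omega>}) \<le> 2 * \<delta>"
    proof (cases "n = 0")
      case False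
      \<comment> \<open>A union bound over \<open>n\<close> truncations, each of probability at most \<open>2 * exp (- L) = 2 * \<delta> / n\<close>.\<close>
      have TM: "T i \<in> borel_measurable M" for i by (rule measurable_from_subalg[OF sub T])
      have "measure M (\<Union>i\<in>{1..n}. {\<omega> \<in> space M. \<xi> i \<omega> \<noteq> T i \<omega>})
          \<le> (\<Sum>i\<in>{1..n}. measure M {\<omega> \<in> space M. \<xi> i \<omega> \<noteq> T i \<omega>})"
        using \<xi>M TM by (intro measure_UNION_le) (auto intro!: borel_measurable_neq)
      also have "\<dots> \<le> (\<Sum>i\<in>{1..n}. 2 * exp (- L))"
      proof (rule sum_mono)
        fix i assume i: "i \<in> {1..n}"
        have "0 < \<theta>" using th by simp
        from finite_measure_subalgebra.measure_truncated_neq_le[OF fms \<xi>M assms(5) this L[OF False] assms(7,9)[OF i]]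
        show "measure M {\<omega> \<in> space M. \<xi> i \<omega> \<noteq> T i \<omega>} \<le> 2 * exp (- L)"
          by (simp only: T_def prob_space mult_1_right)
      qed
      also have "\<dots> = 2 * \<delta>"
        using False \<delta> by (simp add: L_def exp_minus)
      finally show ?thesis .
    qed (use \<delta> in simp)
    note bounds = tail_bounds_zero_to_recip[OF assms(1) fil sub \<xi>M T assms(5) c mgf trunc, unfolded a_def b_def L_def]
    show "let a = (2 powr (2 * \<theta> + 1) + 2) * Gamma (2 * \<theta> + 1)
                + 2 powr (3 * \<theta>) * Gamma (3 * \<theta> + 1) / (3 * ln (real n / \<delta>) powr (\<theta> - 1));
          b = 2 * ln (real n / \<delta>) powr (\<theta> - 1) in
        (\<forall>x \<beta> \<alpha> lam. 0 \<le> x \<and> 0 \<le> \<beta> \<and> b * (MAX i\<in>{1..n}. m i) \<le> \<alpha> \<and>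
             lam \<in> zero_to_recip (2 * \<alpha>) \<longrightarrow>
           measure M (\<Union>k\<in>{1..n}. {\<omega> \<in> space M.
               x \<le> (\<Sum>i=1..k. \<xi> i \<omega>) \<and>
               (\<Sum>i=1..k. a * (K (i - 1) \<omega>)\<^sup>2) \<le> \<alpha> * (\<Sum>i=1..k. \<xi> i \<omega>) + \<beta>})
             \<le> exp (- lam * x + 2 * lam\<^sup>2 * \<beta>) + 2 * \<delta>) \<and>
        (\<forall>x \<beta> lam. 0 \<le> x \<and> 0 \<le> \<beta> \<and>
             lam \<in> zero_to_recip (b * (MAX i\<in>{1..n}. m i)) \<longrightarrow>
           measure M (\<Union>k\<in>{1..n}. {\<omega> \<in> space M.
               x \<le> (\<Sum>i=1..k. \<xi> i \<omega>) \<and>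
               (\<Sum>i=1..k. a * (K (i - 1) \<omega>)\<^sup>2) \<le> \<beta>})
             \<le> exp (- lam * x + lam\<^sup>2 / 2 * \<beta>) + 2 * \<delta>)"
      unfolding Let_def by (rule bounds)
  qed
qed

end
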